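(* Let $Y_{\mathbb N}=\{y_{n1},y_{n2}:n\in\mathbb N\}$ be a countably infinite set in the open square $(-1,1)^2$, and $\{W_n:n\in\mathbb N\}$ a family of pairwise disjoint countable sets in $(-1,1)^2-Y_{\mathbb N}$, each $W_n$ dense in $[-1,1]^2$. Suppose that (1) $\lim_{n\to\infty}d(y_{n1},J_1)=\lim_{n\to\infty}d(y_{n2},J_{-1})=0$; and (2) for every $\beta\in p(Y_{\mathbb N})$ there exists $\varepsilon_\beta>0$ such that $Y_{\mathbb N}\cap p^{-1}([\beta-\varepsilon_\beta,\beta+\varepsilon_\beta])$ is finite. Then there exists a homeomorphism $\psi:[-1,1]^2\to[-1,1]^2$ with zero topological entropy such that for every $n\in\mathbb N$ and every $w\in W_n$, $\omega_\psi(w)=\{y_{n1}\}$ and $\alpha_\psi(w)=\{y_{n2}\}$.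
   Context: $J_i=[-1,1]\times\{i\}$ for $i\in\{-1,1\}$; $d$ is the Euclidean metric and $d(y,J_i)=\inf_{z\in J_i}d(y,z)$. $p:\mathbb R^2\to\mathbb R$ is the projection $p(r,s)=r$. $\omega_\psi(w)$ is the $\omega$-limit set of $w$ under $\psi$ and $\alpha_\psi(w)=\omega_{\psi^{-1}}(w)$. *)

theory Defs
  imports "HOL-Analysis.Analysis"
begin

definition separated_set ::
  "('a::metric_space) set \<Rightarrow> ('a \<Rightarrow> 'a) \<Rightarrow> nat \<Rightarrow> real \<Rightarrow> 'a set \<Rightarrow> bool" where
  "separated_set S f n \<epsilon> E \<longleftrightarrow> E \<subseteq> S \<and>
     (\<forall>x\<in>E. \<forall>y\<in>E. x \<noteq> y \<longrightarrow> (\<exists>k<n. dist ((f^^k) x) ((f^^k) y) > \<epsilon>))"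

text \<open>Maximal cardinality of an (n,eps)-separated set (finite for compact S and continuous f).\<close>
definition max_separated :: "('a::metric_space) set \<Rightarrow> ('a \<Rightarrow> 'a) \<Rightarrow> nat \<Rightarrow> real \<Rightarrow> nat" where
  "max_separated S f n \<epsilon> = Sup {card E | E. finite E \<and> separated_set S f n \<epsilon> E}"

definition topological_entropy :: "('a::metric_space) set \<Rightarrow> ('a \<Rightarrow> 'a) \<Rightarrow> ereal" where
  "topological_entropy S f =
     (SUP \<epsilon>\<in>{0<..}. limsup (\<lambda>n. ereal (ln (real (max_separated S f n \<epsilon>)) / real n)))"

definition omega_limit :: "('a::metric_space \<Rightarrow> 'a) \<Rightarrow> 'a \<Rightarrow> 'a set" where
  "omega_limit f x = {y. \<exists>r. strict_mono r \<and> ((\<lambda>k. (f^^(r k)) x) \<longlonglongrightarrow> y)}"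

definition J :: "real \<Rightarrow> (real \<times> real) set" where
  "J i = {-1..1} \<times> {i}"

definition proj1 :: "real \<times> real \<Rightarrow> real" where
  "proj1 z = fst z"

end

theory Submission
  imports Defs "HOL-Real_Asymp.Real_Asymp"
begin

text \<open>The homeomorphism is a factor of \<open>\<Psi>(x, t) = (G\<^sub>t x, t + 1)\<close> on
  \<open>[-1,1] \<times> [-\<infinity>,\<infinity>]\<close>, where the \<open>G\<^sub>t\<close> are homeomorphisms of \<open>[-1,1]\<close> that depend
  continuously on \<open>t\<close> and converge to the identity as \<open>\<bar>t\<bar> \<rightarrow> \<infinity>\<close>.

  The factor map \<open>P\<close> onto the square is injective except on the two edges \<open>t = \<plusminus>\<infinity>\<close>: it folds them
  onto the horizontal sides together with arcs that run from these sides to the points \<open>y\<^sub>n\<^sub>1\<close> and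
  \<open>y\<^sub>n\<^sub>2\<close> and avoid all \<open>W\<^sub>n\<close>. After a generic shear of the square the arcs are vertical segments, and
  the condition on the strips makes it possible to open them one by one in disjoint columns.

  After a generic affine change of coordinates the points of \<open>\<Union>\<^sub>n W\<^sub>n\<close> have preimages \<open>(x\<^sub>j, t\<^sub>j)\<close> with the
  \<open>t\<^sub>j\<close> distinct modulo 1. So \<open>G\<^sub>t\<close> can be chosen for \<open>t \<in> t\<^sub>j + \<int>\<close>, far out, so as to push towards
  any given abscissa; pushes of size about \<open>1/\<bar>t\<bar>\<close> tend to the identity but have a divergent
  sum, which makes the orbit of \<open>(x\<^sub>j, t\<^sub>j)\<close> converge to any given points of the two edges.

  The entropy vanishes because every orbit makes a uniformly bounded number of steps of size
  at least \<open>\<delta>\<close>, for every \<open>\<delta> > 0\<close>.\<close>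

section \<open>Entropy of maps with few fast steps\<close>

text \<open>Repeating one element pads an enumeration of \<open>B\<close> to a list of length
  exactly \<open>m\<close>, and there are \<open>card A ^ m\<close> such lists over
  \<open>A\<close>. A nonempty \<open>B\<close> provides the element to repeat.\<close>

lemma card_nonempty_subsets_le:
  assumes "finite A"
  shows "card {B. B \<noteq> {} \<and> B \<subseteq> A \<and> card B \<le> m} \<le> card A ^ m"
    and "finite {B. B \<noteq> {} \<and> B \<subseteq> A \<and> card B \<le> m}"
proof -
  let ?L = "{xs. set xs \<subseteq> A \<and> length xs = m}"
  show "finite {B. B \<noteq> {} \<and> B \<subseteq> A \<and> card B \<le> m}"
    by (rule finite_subset[of _ "Pow A"]) (use assms in auto)
  have fL: "finite ?L" using assms by (rule finite_lists_length_eq)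
  have "{B. B \<noteq> {} \<and> B \<subseteq> A \<and> card B \<le> m} \<subseteq> set ` ?L"
  proof clarify
    fix B assume B: "B \<noteq> {}" "B \<subseteq> A" "card B \<le> m"
    then obtain xs where xs: "set xs = B" "distinct xs"
      using finite_distinct_list finite_subset assms by metis
    obtain b where b: "b \<in> B" using B by blast
    have "set (xs @ replicate (m - length xs) b) = B"
      using xs b by auto
    moreover have "length (xs @ replicate (m - length xs) b) = m"
      using xs B distinct_card[of xs] by auto
    ultimately show "B \<in> set ` ?L"
      using B(2) by (metis (mono_tags, lifting) image_eqI mem_Collect_eq)
  qed
  then have "card {B. B \<noteq> {} \<and> B \<subseteq> A \<and> card B \<le> m} \<le> card ?L"
    using fL by (meson card_image_le card_mono finite_imageI le_trans)
  then show "card {B. B \<noteq> {} \<and> B \<subseteq> A \<and> card B \<le> m} \<le> card A ^ m"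
    using assms by (simp add: card_lists_length_eq)
qed

text \<open>A point of \<open>E\<close> is determined by the cells that its orbit visits at the multiples of \<open>T\<close> and
  right after each of its at most \<open>N\<close> big steps.\<close>

lemma separated_set_card_le:
  fixes S :: "'a::metric_space set"
  assumes D: "finite D" "\<And>x. x \<in> S \<Longrightarrow> cell x \<in> D" "\<And>x. x \<in> S \<Longrightarrow> dist x (cell x) < \<epsilon> / 8"
    and f: "f ` S \<subseteq> S" and \<epsilon>: "\<epsilon> > 0" and T: "T > 0" and n: "n > 0"
    and N: "\<And>x. x \<in> S \<Longrightarrow> card {k. k < n \<and> dist ((f^^Suc k) x) ((f^^k) x) \<ge> \<epsilon> / (4 * real T)} \<le> N"
    and E: "finite E" "separated_set S f n \<epsilon> E"
  shows "card E \<le> card D ^ (n div T + 1) * (n * card D) ^ (N + 1)"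
proof -
  \<comment> \<open>In a step that is not bad a point moves by less than
    \<open>\<epsilon> / (4 * real T)\<close>. Two such orbits separate by at most \<epsilon> / 2
    within a block of length \<open>T\<close>; starting in a common cell, at distance below
    \<epsilon> / 4, they stay closer than \<epsilon>.\<close>
  define bad where "bad x k \<longleftrightarrow> dist ((f^^Suc k) x) ((f^^k) x) \<ge> \<epsilon> / (4 * real T)" for x k
  \<comment> \<open>Index 0 is always recorded: this keeps \<open>B x\<close> nonempty for the count
    of subsets and accounts for the size \<open>N + 1\<close>.\<close>
  define B where "B x = {(k, cell ((f^^k) x)) | k. k < n \<and> (k = 0 \<or> bad x (k - 1))}" for x
  define L where "L x = map (\<lambda>i. cell ((f^^(i * T)) x)) [0..<n div T + 1]" for x
  let ?LL = "{xs. set xs \<subseteq> D \<and> length xs = n div T + 1}"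
  let ?BB = "{B. B \<noteq> {} \<and> B \<subseteq> {..<n} \<times> D \<and> card B \<le> N + 1}"
  have ES: "E \<subseteq> S" using E by (simp add: separated_set_def)
  have it: "(f^^k) x \<in> S" if "x \<in> S" for x k
    using that f by (induction k) auto
  have cell_dist: "dist x y < \<epsilon> / 4" if "x \<in> S" "y \<in> S" "cell x = cell y" for x y
  proof -
    have "dist y (cell x) < \<epsilon> / 8" using D(3)[OF that(2)] that(3) by simp
    with D(3)[OF that(1)] dist_triangle2[of x y "cell x"] show ?thesis by linarith
  qed
  have same: "x = y" if xy: "x \<in> E" "y \<in> E" "L x = L y" "B x = B y" for x y
  proof (rule ccontr)
    assume "x \<noteq> y"
    then obtain k where k: "k < n" "dist ((f^^k) x) ((f^^k) y) > \<epsilon>"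
      using E xy unfolding separated_set_def by blast
    have S: "x \<in> S" "y \<in> S" using ES xy by auto
    have Leq: "cell ((f^^(i * T)) x) = cell ((f^^(i * T)) y)" if "i * T < n" for i
    proof -
      have "i < n div T + 1" using that T
        by (metis add.commute div_less_iff_less_mult less_Suc_eq less_or_eq_imp_le linorder_not_le not_less_eq plus_1_eq_Suc)
      moreover have "L x ! i = L y ! i" using xy by simp
      ultimately show ?thesis by (simp add: L_def del: upt_Suc)
    qed
    have Beq: "bad y k \<and> cell ((f^^Suc k) x) = cell ((f^^Suc k) y)"
      if "Suc k < n" "bad x k" "B x = B y" for x y k
    proof -
      have "(Suc k, cell ((f^^Suc k) x)) \<in> B x" unfolding B_def using that by force
      then have "(Suc k, cell ((f^^Suc k) x)) \<in> B y" using that by simp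
      then show ?thesis by (auto simp: B_def)
    qed
    \<comment> \<open>The bound grows with the number of steps since the last multiple of
      \<open>T\<close>. At multiples of \<open>T\<close>, by \<open>L\<close>, and after a bad step
      of either orbit, by \<open>B\<close>, both points are again in one cell.\<close>
    have "dist ((f^^k) x) ((f^^k) y) \<le> \<epsilon> / 4 + 2 * real (k mod T) * (\<epsilon> / (4 * real T))"
      if "k < n" for k using that
    proof (induction k)
      case 0
      then show ?case using cell_dist[OF S] Leq[of 0] n by simp
    next
      case (Suc k)
      note closeI = less_imp_le[OF cell_dist[OF it[OF S(1), of "Suc k"] it[OF S(2), of "Suc k"]]]
      have pos: "0 \<le> 2 * real (Suc k mod T) * (\<epsilon> / (4 * real T))" using \<epsilon> by simp
      consider "Suc k mod T = 0" | "bad x k \<or> bad y k" | "Suc k mod T \<noteq> 0" "\<not> bad x k" "\<not> bad y k" by blast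
      then show ?case
      proof cases
        case 1
        then obtain i where "Suc k = i * T" by (metis mod_0_imp_dvd dvd_def mult.commute)
        then show ?thesis using Leq[of i] Suc.prems closeI pos by (simp del: funpow.simps)
      next
        case 2
        then have "cell ((f^^Suc k) x) = cell ((f^^Suc k) y)"
          using Beq[of k x y] Beq[of k y x] Suc.prems xy(4) by auto
        then show ?thesis using closeI pos by (simp del: funpow.simps)
      next
        case 3
        then have m: "Suc k mod T = Suc (k mod T)" by (simp add: mod_Suc split: if_splits)
        have "dist ((f^^Suc k) x) ((f^^Suc k) y)
           \<le> dist ((f^^k) x) ((f^^k) y) + 2 * (\<epsilon> / (4 * real T))"
          using 3 dist_triangle[of "(f^^Suc k) x" "(f^^Suc k) y" "(f^^k) x"]
            dist_triangle[of "(f^^k) x" "(f^^Suc k) y" "(f^^k) y"]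
          by (simp add: bad_def dist_commute not_le del: funpow.simps)
        moreover have "dist ((f^^k) x) ((f^^k) y) \<le> \<epsilon> / 4 + 2 * real (k mod T) * (\<epsilon> / (4 * real T))"
          using Suc by simp
        ultimately show ?thesis unfolding m of_nat_Suc by (simp add: algebra_simps del: funpow.simps)
      qed
    qed
    from this[OF k(1)] have "dist ((f^^k) x) ((f^^k) y) \<le> \<epsilon> / 4 + 2 * real T * (\<epsilon> / (4 * real T))"
      using mod_less_divisor[OF T, of k] \<epsilon> T
      by (elim order.trans) (intro add_left_mono mult_right_mono, auto)
    also have "\<dots> < \<epsilon>" using T \<epsilon> by simp
    finally show False using k by simp
  qed
  have inj: "inj_on (\<lambda>x. (L x, B x)) E" using same by (auto simp: inj_on_def)
  have LL: "L x \<in> ?LL" if "x \<in> S" for x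
    using D(2) it[OF that] by (auto simp: L_def)
  have BB: "B x \<in> ?BB" if x: "x \<in> S" for x
  proof -
    have "B x \<noteq> {}" using n by (auto simp: B_def)
    moreover have "B x \<subseteq> {..<n} \<times> D" using D(2) it[OF x] by (auto simp: B_def)
    moreover have "card (B x) \<le> N + 1"
    proof -
      let ?K = "{k. k < n \<and> bad x k}"
      have "B x \<subseteq> (\<lambda>k. (k, cell ((f^^k) x))) ` insert 0 (Suc ` ?K)"
      proof
        fix z assume "z \<in> B x"
        then obtain k where k: "z = (k, cell ((f^^k) x))" "k < n" "k = 0 \<or> bad x (k - 1)"
          by (auto simp: B_def)
        then have "k \<in> insert 0 (Suc ` ?K)" by (cases k) auto
        with k show "z \<in> (\<lambda>k. (k, cell ((f^^k) x))) ` insert 0 (Suc ` ?K)" by blast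
      qed
      then have "card (B x) \<le> card (insert 0 (Suc ` ?K))"
        by (rule surj_card_le[rotated]) simp
      also have "\<dots> \<le> Suc (card ?K)"
        by (simp add: card_insert_if card_image)
      also have "\<dots> \<le> N + 1" using N[OF x] by (simp add: bad_def del: funpow.simps)
      finally show ?thesis .
    qed
    ultimately show ?thesis by simp
  qed
  have fin: "finite ?LL" "finite ?BB"
    using D(1) finite_lists_length_eq card_nonempty_subsets_le(2)[of "{..<n} \<times> D"] by auto
  have "card E = card ((\<lambda>x. (L x, B x)) ` E)" using inj by (simp add: card_image)
  also have "\<dots> \<le> card (?LL \<times> ?BB)"
    by (rule card_mono) (use fin LL BB ES in auto)
  also have "\<dots> = card ?LL * card ?BB" by (rule card_cartesian_product)
  also have "\<dots> \<le> card D ^ (n div T + 1) * (card ({..<n} \<times> D)) ^ (N + 1)"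
    using card_nonempty_subsets_le(1)[of "{..<n} \<times> D" "N+1"] D(1)
    by (intro mult_le_mono) (auto simp: card_lists_length_eq simp del: power_Suc card_cartesian_product)
  finally show ?thesis by (simp only: card_cartesian_product card_lessThan)
qed

text \<open>With the number of bad steps bounded, their positions and cells contribute only a
  polynomial factor in \<open>n\<close>. The growth rate is thus at most \<open>ln C / T\<close>,
  and \<open>T\<close> is arbitrary.\<close>

lemma topological_entropy_eq_0:
  fixes S :: "'a::metric_space set"
  assumes S: "compact S" and f: "f ` S \<subseteq> S"
    and slow: "\<And>\<delta>. \<delta> > 0 \<Longrightarrow>
      \<exists>N. \<forall>x\<in>S. \<forall>n. card {k. k < n \<and> dist ((f^^Suc k) x) ((f^^k) x) \<ge> \<delta>} \<le> N"
  shows "topological_entropy S f = 0"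
proof -
  let ?h = "\<lambda>\<epsilon> n. ereal (ln (real (max_separated S f n \<epsilon>)) / real n)"
  have nonneg: "0 \<le> ?h \<epsilon> n" for \<epsilon> n
    by (cases "max_separated S f n \<epsilon>") auto
  have upper: "limsup (?h \<epsilon>) \<le> 0" if \<epsilon>: "\<epsilon> > 0" for \<epsilon>
  proof -
    obtain D where D: "finite D" "D \<subseteq> S" "S \<subseteq> (\<Union>d\<in>D. ball d (\<epsilon> / 8))"
      using compactE_image[OF S, of S "\<lambda>d. ball d (\<epsilon> / 8)"] \<epsilon> by force
    define cell where "cell x = (SOME d. d \<in> D \<and> dist x d < \<epsilon> / 8)" for x
    have cell: "cell x \<in> D \<and> dist x (cell x) < \<epsilon> / 8" if "x \<in> S" for x
      unfolding cell_def by (rule someI_ex) (use D(3) that in \<open>force simp: dist_commute\<close>)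
    \<comment> \<open>The added 1 keeps \<open>C\<close> positive and \<open>ln C\<close>
      nonnegative even if there are no cells.\<close>
    define C where "C = card D + 1"
    have *: "limsup (?h \<epsilon>) \<le> ereal (ln (real C) / real T)" if T: "T > 0" for T
    proof -
      have "\<epsilon> / (4 * real T) > 0" using \<epsilon> T by simp
      from slow[OF this] obtain N where N: "\<And>x n. x \<in> S \<Longrightarrow>
          card {k. k < n \<and> dist ((f^^Suc k) x) ((f^^k) x) \<ge> \<epsilon> / (4 * real T)} \<le> N" by blast
      have bound: "max_separated S f n \<epsilon> \<le> C ^ (n div T + 1) * (n * C) ^ (N + 1)" if n: "n > 0" for n
      proof -
        have "card E \<le> C ^ (n div T + 1) * (n * C) ^ (N + 1)"
          if E: "finite E" "separated_set S f n \<epsilon> E" for E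
        proof -
          have "card E \<le> card D ^ (n div T + 1) * (n * card D) ^ (N + 1)"
            by (rule separated_set_card_le[OF D(1) _ _ f \<epsilon> T n N E]) (use cell in auto)
          also have "\<dots> \<le> C ^ (n div T + 1) * (n * C) ^ (N + 1)"
            unfolding C_def by (intro mult_le_mono power_mono) auto
          finally show ?thesis .
        qed
        moreover have "separated_set S f n \<epsilon> {}" by (simp add: separated_set_def)
        ultimately show ?thesis
          unfolding max_separated_def by (intro cSup_least) auto
      qed
      let ?g = "\<lambda>n. ((real n / real T + 1) * ln (real C) + real (N + 1) * (ln (real n) + ln (real C))) / real n"
      have "?h \<epsilon> n \<le> ereal (?g n)" if n: "n > 0" for n
      proof -
        have C: "C > 0" by (simp add: C_def)
        have "ln (real (max_separated S f n \<epsilon>)) \<le> ln (real (C ^ (n div T + 1) * (n * C) ^ (N + 1)))"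
        proof (cases "max_separated S f n \<epsilon> = 0")
          \<comment> \<open>The left-hand side is \<open>ln 0 = 0\<close>, so the right-hand side
            must be shown to be nonnegative.\<close>
          case True
          have "1 \<le> C ^ (n div T + 1) * (n * C) ^ (N + 1)" using n C by simp
          then have "1 \<le> real (C ^ (n div T + 1) * (n * C) ^ (N + 1))" by linarith
          then show ?thesis using True by (simp del: of_nat_mult of_nat_power)
        next
          case False
          have "real (max_separated S f n \<epsilon>) \<le> real (C ^ (n div T + 1) * (n * C) ^ (N + 1))"
            using bound[OF n] by (simp only: of_nat_le_iff)
          moreover have "0 < real (max_separated S f n \<epsilon>)" using False by simp
          ultimately show ?thesis by (meson ln_mono)
        qed
        also have "\<dots> = real (n div T + 1) * ln (real C) + real (N + 1) * (ln (real n) + ln (real C))"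
          using n C by (simp add: ln_mult ln_realpow del: power_Suc)
        also have "\<dots> \<le> (real n / real T + 1) * ln (real C) + real (N + 1) * (ln (real n) + ln (real C))"
          using C of_nat_div_le_of_nat[of n T] by (intro add_right_mono mult_right_mono) auto
        finally show ?thesis using n by (simp add: divide_right_mono)
      qed
      then have "limsup (?h \<epsilon>) \<le> limsup (\<lambda>n. ereal (?g n))"
        by (intro Limsup_mono) (auto simp: eventually_sequentially intro!: exI[of _ 1])
      also have "(\<lambda>n. ?g n) \<longlonglongrightarrow> ln (real C) / real T"
        using T by real_asymp (simp add: field_simps)
      then have "(\<lambda>n. ereal (?g n)) \<longlonglongrightarrow> ereal (ln (real C) / real T)" by simp
      then have "limsup (\<lambda>n. ereal (?g n)) = ereal (ln (real C) / real T)"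
        by (rule lim_imp_Limsup[rotated]) simp
      finally show ?thesis .
    qed
    have "(\<lambda>T. ereal (ln (real C) / real (Suc T))) \<longlonglongrightarrow> ereal 0"
      unfolding lim_ereal by real_asymp
    then have "limsup (?h \<epsilon>) \<le> ereal 0"
      by (rule LIMSEQ_le_const) (use * in blast)
    then show ?thesis by (simp add: zero_ereal_def)
  qed
  have lower: "0 \<le> limsup (?h \<epsilon>)" for \<epsilon>
    by (rule le_Limsup) (use nonneg in \<open>auto intro!: always_eventually\<close>)
  show ?thesis unfolding topological_entropy_def
    by (rule antisym) (use upper lower in \<open>auto intro!: SUP_least SUP_upper2[of 1]\<close>)
qed

section \<open>The compactified line\<close>

text \<open>An order-preserving homeomorphism from (-1, 1) onto the real line, with inverse
  \<open>from_line\<close>; the interval [-1, 1] thereby models the line with the two ends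
  \<plusminus>\<infinity>.\<close>

definition to_line :: "real \<Rightarrow> real" where
  "to_line s = s / (1 - \<bar>s\<bar>)"

definition from_line :: "real \<Rightarrow> real" where
  "from_line t = t / (1 + \<bar>t\<bar>)"

lemma abs_from_line_less [simp]: "\<bar>from_line t\<bar> < 1"
  by (simp add: from_line_def divide_simps)

text \<open>The weight \<open>1 - \<bar>s\<bar>\<close> is of order \<open>1 / \<bar>t\<bar>\<close>
  in the line coordinate. It gives the pushes a size that tends to 0 but is not summable along an
  orbit.\<close>

lemma one_minus_abs_from_line: "1 - \<bar>from_line t\<bar> = 1 / (1 + \<bar>t\<bar>)"
  by (simp add: from_line_def divide_simps add_nonneg_eq_0_iff)

lemma to_line_from_line [simp]: "to_line (from_line t) = t"
  unfolding to_line_def one_minus_abs_from_line by (simp add: from_line_def)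

lemma from_line_to_line [simp]:
  assumes "\<bar>s\<bar> < 1" shows "from_line (to_line s) = s"
proof -
  have "1 + \<bar>to_line s\<bar> = 1 / (1 - \<bar>s\<bar>)"
    using assms by (simp add: to_line_def field_simps)
  then show ?thesis using assms by (simp add: from_line_def) (simp add: to_line_def)
qed

lemma from_line_at_top: "(from_line \<longlongrightarrow> 1) at_top"
proof (rule Lim_transform_eventually)
  show "((\<lambda>t::real. 1 - 1 / (1 + t)) \<longlongrightarrow> 1) at_top" by real_asymp
  show "\<forall>\<^sub>F t in at_top. 1 - 1 / (1 + t) = from_line t"
    using eventually_ge_at_top[of 0] by eventually_elim (simp add: from_line_def field_simps)
qed

lemma from_line_at_bot: "(from_line \<longlongrightarrow> -1) at_bot"
proof (rule Lim_transform_eventually)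
  show "((\<lambda>t::real. 1 / (1 - t) - 1) \<longlongrightarrow> -1) at_bot" by real_asymp
  show "\<forall>\<^sub>F t in at_bot. 1 / (1 - t) - 1 = from_line t"
    using eventually_le_at_bot[of 0] by eventually_elim (simp add: from_line_def field_simps)
qed

text \<open>The map \<open>t \<mapsto> \<mu> t + q\<close> of the real line, transported to \<open>(-1,1)\<close> by \<open>from_line\<close> and
  written so that it makes sense at \<open>\<plusminus>1\<close>, which it fixes.\<close>

definition line_affine :: "real \<Rightarrow> real \<Rightarrow> real \<Rightarrow> real" where
  "line_affine \<mu> q s = (\<mu> * s + q * (1 - \<bar>s\<bar>)) / ((1 - \<bar>s\<bar>) + \<bar>\<mu> * s + q * (1 - \<bar>s\<bar>)\<bar>)"

lemma line_affine_end: "\<lbrakk>\<mu> > 0; \<bar>s\<bar> = 1\<rbrakk> \<Longrightarrow> line_affine \<mu> q s = s"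
  by (auto simp: line_affine_def abs_mult abs_if split: if_splits)

lemma line_affine_eq:
  assumes "\<bar>s\<bar> < 1"
  shows "line_affine \<mu> q s = from_line (\<mu> * to_line s + q)"
proof -
  have p: "1 - \<bar>s\<bar> > 0" using assms by simp
  have e: "\<mu> * to_line s + q = (\<mu> * s + q * (1 - \<bar>s\<bar>)) / (1 - \<bar>s\<bar>)"
    using p by (simp add: to_line_def add_divide_distrib)
  have "1 + \<bar>\<mu> * to_line s + q\<bar> = ((1 - \<bar>s\<bar>) + \<bar>\<mu> * s + q * (1 - \<bar>s\<bar>)\<bar>) / (1 - \<bar>s\<bar>)"
    unfolding e abs_divide using p by (simp add: field_simps)
  then show ?thesis unfolding from_line_def line_affine_def e using p by simp
qed

lemma to_line_line_affine: "\<bar>s\<bar> < 1 \<Longrightarrow> to_line (line_affine \<mu> q s) = \<mu> * to_line s + q"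
  by (simp add: line_affine_eq)

lemma abs_line_affine_less: "\<bar>s\<bar> < 1 \<Longrightarrow> \<bar>line_affine \<mu> q s\<bar> < 1"
  by (simp add: line_affine_eq)

lemma abs_line_affine_le: "\<lbrakk>\<mu> > 0; \<bar>s\<bar> \<le> 1\<rbrakk> \<Longrightarrow> \<bar>line_affine \<mu> q s\<bar> \<le> 1"
  by (cases "\<bar>s\<bar> = 1") (simp_all add: line_affine_end less_imp_le abs_line_affine_less)

lemma line_affine_inverse:
  assumes "\<mu> > 0" "\<bar>s\<bar> \<le> 1"
  shows "line_affine (1 / \<mu>) (- q / \<mu>) (line_affine \<mu> q s) = s"
    and "line_affine \<mu> q (line_affine (1 / \<mu>) (- q / \<mu>) s) = s"
  using assms
  by (cases "\<bar>s\<bar> = 1"; simp add: line_affine_end line_affine_eq field_simps)+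

text \<open>The denominator never vanishes: it equals \<mu> where \<open>\<bar>s\<bar> = 1\<close>,
  and elsewhere it is at least \<open>1 - \<bar>s\<bar>\<close>, which is positive.\<close>

lemma continuous_on_line_affine:
  assumes "\<mu> > 0" "continuous_on X q" "continuous_on X s" "\<And>x. x \<in> X \<Longrightarrow> \<bar>s x :: real\<bar> \<le> 1"
  shows "continuous_on X (\<lambda>x. line_affine \<mu> (q x) (s x))"
  unfolding line_affine_def
proof (intro continuous_intros assms ballI)
  fix x assume "x \<in> X"
  then have "\<bar>s x\<bar> \<le> 1" by (rule assms)
  show "1 - \<bar>s x\<bar> + \<bar>\<mu> * s x + q x * (1 - \<bar>s x\<bar>)\<bar> \<noteq> 0"
  proof (cases "\<bar>s x\<bar> = 1")
    case True
    then show ?thesis using assms(1) by (auto simp: abs_if split: if_splits)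
  qed (use \<open>\<bar>s x\<bar> \<le> 1\<close> in auto)
qed

section \<open>Generic parameters and slow convergence\<close>

text \<open>A pair with \<open>b \<noteq> 0\<close> excludes the single value
  \<open>- a / b\<close>, and a pair with \<open>b = 0\<close> has \<open>a \<noteq> 0\<close> and
  excludes nothing. Countably many exclusions do not exhaust an interval.\<close>

lemma exists_generic_parameter:
  fixes A :: "(real \<times> real) set"
  assumes "countable A" "(0, 0) \<notin> A" "0 < \<epsilon>"
  obtains l where "0 < l" "l < \<epsilon>" "\<And>a b. (a, b) \<in> A \<Longrightarrow> a + l * b \<noteq> 0"
proof -
  have "uncountable ({0<..<\<epsilon>} - (\<lambda>(a, b). - a / b) ` A)"
    using assms by (intro uncountable_minus_countable countable_image) (auto simp: uncountable_open_interval)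
  then obtain l where l: "l \<in> {0<..<\<epsilon>}" "l \<notin> (\<lambda>(a, b). - a / b) ` A"
    by (metis Diff_iff countable_empty ex_in_conv)
  have "a + l * b \<noteq> 0" if "(a, b) \<in> A" for a b
  proof
    assume "a + l * b = 0"
    moreover have "b \<noteq> 0" using that assms(2) \<open>a + l * b = 0\<close> by auto
    ultimately have "l = - a / b" by (simp add: field_simps)
    with l that show False by force
  qed
  with l show ?thesis using that by auto
qed

text \<open>Since \<open>\<Sum>1/(n+L)\<close> diverges, so would the decrements of \<open>d\<close> if its limit were positive.\<close>

lemma slow_decrease_tendsto_0:
  fixes d :: "nat \<Rightarrow> real"
  assumes nonneg: "\<And>n. d n \<ge> 0" and "\<kappa> > 0"
    and dec: "\<And>n. d n - d (Suc n) \<ge> \<kappa> / (real n + L) * d (Suc n)" and L: "L > 0"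
  shows "d \<longlonglongrightarrow> 0"
proof -
  have "d (Suc n) \<le> d n" for n
  proof -
    have "0 \<le> \<kappa> / (real n + L) * d (Suc n)"
      using assms(2) L nonneg by (intro mult_nonneg_nonneg divide_nonneg_nonneg) auto
    with dec[of n] show ?thesis by linarith
  qed
  then have "decseq d" by (rule decseq_SucI)
  then obtain l where l: "d \<longlonglongrightarrow> l" "\<And>n. l \<le> d n"
    using decseq_convergent[of d 0] nonneg by blast
  have "l = 0"
  proof (rule ccontr)
    assume "l \<noteq> 0"
    then have "l > 0" using l LIMSEQ_le_const[OF l(1), of 0] nonneg by fastforce
    have "summable (\<lambda>n. d n - d (Suc n))"
      using telescope_summable'[OF l(1)] by simp
    then have "summable (\<lambda>n. \<kappa> / (real n + L) * l)"
    proof (rule summable_comparison_test')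
      fix n :: nat
      have "\<kappa> / (real n + L) * l \<le> \<kappa> / (real n + L) * d (Suc n)"
        using l(2) assms(2) L by (intro mult_left_mono) auto
      moreover have "0 \<le> \<kappa> / (real n + L) * l"
        using \<open>l > 0\<close> assms(2) L by simp
      ultimately show "norm (\<kappa> / (real n + L) * l) \<le> d n - d (Suc n)"
        using dec[of n] unfolding real_norm_def by linarith
    qed
    then have "summable (\<lambda>n. inverse (\<kappa> * l) * (\<kappa> / (real n + L) * l))" by (rule summable_mult)
    then have *: "summable (\<lambda>n. 1 / (real n + L))"
      using \<open>l > 0\<close> assms(2) by (simp add: field_simps)
    obtain m :: nat where m: "L \<le> real m" using real_arch_simple by blast
    have "summable (\<lambda>n. 1 / real (n + Suc m))"
      using * by (rule summable_comparison_test'[where N=0]) (use m L in \<open>auto simp: frac_le\<close>)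
    then have "summable (\<lambda>n. 1 / real n)" using summable_iff_shift by blast
    then show False using not_summable_harmonic[where 'a=real] by (simp add: field_simps)
  qed
  with l show ?thesis by simp
qed

text \<open>Convex combination with \<open>c\<close> keeps the sequence in a compact part of (-1,
  1), where \<open>1 - (X n)\<^sup>2\<close> is bounded below, so the slow-decrease criterion
  applies to \<open>\<bar>X n - c\<bar>\<close>. The rate may refer to the old point, as for forward
  orbits, or to the new one, as for backward orbits.\<close>

lemma contracting_sequence_tendsto:
  fixes X a :: "nat \<Rightarrow> real"
  assumes step: "\<And>n. X (Suc n) - c = a n * (X n - c)" and a: "\<And>n. 0 \<le> a n" "\<And>n. a n \<le> 1"
    and "\<bar>X 0\<bar> < 1" "\<bar>c\<bar> < 1" and "\<kappa> > 0" "L > 0"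
    and rate: "\<And>n. 1 - a n \<ge> \<kappa> / (real n + L) * (1 - (X n)\<^sup>2) * a n \<or>
                    1 - a n \<ge> \<kappa> / (real n + L) * (1 - (X (Suc n))\<^sup>2) * a n"
  shows "X \<longlonglongrightarrow> c"
proof -
  define M where "M = max \<bar>X 0\<bar> \<bar>c\<bar>"
  have M: "\<bar>X n\<bar> \<le> M" for n
  proof (induction n)
    case (Suc n)
    have "X (Suc n) = a n * X n + (1 - a n) * c" using step[of n] by (simp add: algebra_simps)
    then have "\<bar>X (Suc n)\<bar> \<le> a n * \<bar>X n\<bar> + (1 - a n) * \<bar>c\<bar>"
      using a[of n] abs_triangle_ineq[of "a n * X n" "(1 - a n) * c"] by (simp add: abs_mult)
    also have "\<dots> \<le> a n * M + (1 - a n) * M"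
      using a[of n] Suc by (intro add_mono mult_left_mono) (auto simp: M_def)
    finally show ?case by (simp add: algebra_simps)
  qed (simp add: M_def)
  have M1: "0 \<le> M" "M < 1" using assms by (auto simp: M_def)
  have sq: "1 - (X n)\<^sup>2 \<ge> 1 - M\<^sup>2" for n
    using M[of n] M1 by (simp add: abs_le_square_iff[symmetric])
  have pos: "1 - M\<^sup>2 > 0" using M1 by (simp add: power_less_one_iff abs_square_less_1)
  have "(\<lambda>n. \<bar>X n - c\<bar>) \<longlonglongrightarrow> 0"
  proof (rule slow_decrease_tendsto_0)
    show "0 < \<kappa> * (1 - M\<^sup>2)" using pos assms by simp
    fix n
    have r: "1 - a n \<ge> \<kappa> / (real n + L) * (1 - M\<^sup>2) * a n"
    proof -
      have "\<kappa> / (real n + L) * (1 - M\<^sup>2) * a n \<le> \<kappa> / (real n + L) * (1 - (X m)\<^sup>2) * a n" for m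
        using sq[of m] a assms by (intro mult_right_mono mult_left_mono) auto
      then show ?thesis using rate[of n] by (meson order_trans)
    qed
    have "\<kappa> * (1 - M\<^sup>2) / (real n + L) * \<bar>X (Suc n) - c\<bar>
       = (\<kappa> / (real n + L) * (1 - M\<^sup>2) * a n) * \<bar>X n - c\<bar>"
      using a[of n] by (simp add: step abs_mult)
    also have "\<dots> \<le> (1 - a n) * \<bar>X n - c\<bar>" using r by (intro mult_right_mono) auto
    also have "\<dots> = \<bar>X n - c\<bar> - \<bar>X (Suc n) - c\<bar>"
      using a[of n] by (simp add: step abs_mult left_diff_distrib)
    finally show "\<kappa> * (1 - M\<^sup>2) / (real n + L) * \<bar>X (Suc n) - c\<bar> \<le> \<bar>X n - c\<bar> - \<bar>X (Suc n) - c\<bar>" .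
  qed (use assms in auto)
  then show ?thesis by (simp add: tendsto_rabs_zero_iff LIM_zero_iff)
qed

section \<open>A time-dependent drift\<close>

lemma abs_sin_add_int_pi: "\<bar>sin (x + of_int k * pi)\<bar> = \<bar>sin (x :: real)\<bar>"
proof -
  have s: "sin (of_int k * pi) = 0" using sin_zero_iff_int2 by blast
  then have "(cos (of_int k * pi))\<^sup>2 = 1" using sin_cos_squared_add[of "of_int k * pi"] by simp
  then have "\<bar>cos (of_int k * pi)\<bar> = 1" by (auto simp: power2_eq_1_iff)
  with s show ?thesis by (simp add: sin_add abs_mult)
qed

text \<open>The peaks at \<open>t0 + \<int>\<close> become narrower as \<open>\<bar>u\<bar>\<close> grows, so that along any other coset of
  \<open>\<int>\<close> the function is eventually 0.\<close>

definition comb :: "real \<Rightarrow> real \<Rightarrow> real \<Rightarrow> real" where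
  "comb R t0 u = max 0 (1 - \<bar>sin (pi * (u - t0))\<bar> * (R + \<bar>u\<bar>))"

lemma comb_bounds: "R \<ge> 0 \<Longrightarrow> 0 \<le> comb R t0 u \<and> comb R t0 u \<le> 1"
  by (simp add: comb_def)

lemma comb_coset: "\<bar>sin (pi * (u + of_int k - t0))\<bar> = \<bar>sin (pi * (u - t0))\<bar>"
  using abs_sin_add_int_pi[of "pi * (u - t0)" k] by (simp add: algebra_simps)

lemma comb_eq_1: "comb R t0 (t0 + of_int k) = 1"
  using comb_coset[of t0 k t0] by (simp add: comb_def)

lemma comb_eq_0:
  assumes "1 \<le> \<bar>sin (pi * (u - t0))\<bar> * (R + \<bar>u + of_int k\<bar>)"
  shows "comb R t0 (u + of_int k) = 0"
  using assms by (simp add: comb_def comb_coset)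

definition unit_ramp :: "real \<Rightarrow> real" where
  "unit_ramp u = max 0 (min 1 u)"

lemma drift_lipschitz:
  assumes "\<bar>c\<bar> \<le> 1" "\<bar>x\<bar> \<le> 1" "\<bar>y\<bar> \<le> (1::real)"
  shows "\<bar>(c - x) * (1 - x\<^sup>2) - (c - y) * (1 - y\<^sup>2)\<bar> \<le> 6 * \<bar>x - y\<bar>"
proof -
  have e: "(c - x) * (1 - x\<^sup>2) - (c - y) * (1 - y\<^sup>2) =
     (x\<^sup>2 + x * y + y\<^sup>2 - 1 - c * (x + y)) * (x - y)"
    by (simp add: algebra_simps power2_eq_square power3_eq_cube)
  have "\<bar>c * (x + y)\<bar> \<le> 1 * 2"
    unfolding abs_mult using assms by (intro mult_mono) auto
  moreover have "\<bar>x * y\<bar> \<le> 1 * 1"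
    unfolding abs_mult using assms by (intro mult_mono) auto
  moreover have "x\<^sup>2 \<le> 1" "y\<^sup>2 \<le> 1" using assms by (simp_all add: abs_square_le_1)
  moreover have "0 \<le> x\<^sup>2" "0 \<le> y\<^sup>2" by simp_all
  ultimately have "\<bar>x\<^sup>2 + x * y + y\<^sup>2 - 1 - c * (x + y)\<bar> \<le> 6" by linarith
  then show ?thesis unfolding e abs_mult by (intro mult_right_mono) auto
qed

lemma drift_bound:
  assumes "\<bar>c\<bar> \<le> 1" "\<bar>x\<bar> \<le> (1::real)"
  shows "\<bar>(c - x) * (1 - x\<^sup>2)\<bar> \<le> 2"
proof -
  have "\<bar>c - x\<bar> \<le> 2" "\<bar>1 - x\<^sup>2\<bar> \<le> 1" using assms by (auto simp: abs_square_le_1)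
  then show ?thesis unfolding abs_mult using mult_mono[of "\<bar>c - x\<bar>" 2 "\<bar>1 - x\<^sup>2\<bar>" 1] by simp
qed

text \<open>\<open>E\<close> sums one comb for each coset \<open>t j + \<int>\<close>, multiplied by
  a field that vanishes at \<plusminus>1 and pulls towards \<open>c j\<close> in the far future and,
  along backward orbits, towards \<open>c' j\<close> in the far past. The Lipschitz constant 1/2
  will make perturbations of the identity by \<open>E\<close> injective.\<close>

lemma drift_field_exists:
  fixes t c c' :: "nat \<Rightarrow> real"
  assumes t: "\<And>i j k. i \<noteq> j \<Longrightarrow> t i - t j \<noteq> of_int k"
    and c: "\<And>j. \<bar>c j\<bar> < 1" and c': "\<And>j. \<bar>c' j\<bar> < 1"
  obtains E :: "real \<Rightarrow> real \<Rightarrow> real" where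
    "continuous_on (UNIV \<times> {-1..1}) (\<lambda>(u, x). E u x)"
    "\<And>u x. \<bar>x\<bar> \<le> 1 \<Longrightarrow> \<bar>E u x\<bar> \<le> 1"
    "\<And>u. E u 1 = 0" "\<And>u. E u (-1) = 0"
    "\<And>u x y. \<bar>x\<bar> \<le> 1 \<Longrightarrow> \<bar>y\<bar> \<le> 1 \<Longrightarrow> \<bar>E u x - E u y\<bar> \<le> \<bar>x - y\<bar> / 2"
    "\<And>j. \<exists>\<eta>>0. \<eta> \<le> 1 \<and> (\<exists>K. \<forall>k\<ge>K. \<forall>x. E (t j + real k) x = \<eta> * ((c j - x) * (1 - x\<^sup>2)) \<and>
        E (t j - real k) x = - \<eta> * ((c' j - x) * (1 - x\<^sup>2)))"
proof -
  define \<sigma> where "\<sigma> i j = \<bar>sin (pi * (t i - t j))\<bar>" for i j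
  have \<sigma>: "\<sigma> i j > 0" if "i \<noteq> j" for i j
  proof -
    have "pi * (t i - t j) \<noteq> of_int n * pi" for n
      using t[OF that, of n] by (simp add: mult.commute)
    then show ?thesis unfolding \<sigma>_def by (simp add: sin_zero_iff_int2)
  qed
  \<comment> \<open>This makes comb \<open>j\<close> vanish on all earlier cosets
    \<open>t i + \<int>\<close>, \<open>i < j\<close>. Along the coset of \<open>t j\<close> only
    the finitely many combs with smaller index can then interfere, and those die out far
    away.\<close>
  define R where "R j = (\<Sum>i<j. 1 / \<sigma> i j)" for j
  have R0: "R j \<ge> 0" for j unfolding R_def by (intro sum_nonneg) (auto simp: \<sigma>_def)
  have R: "1 \<le> \<sigma> i j * R j" if "i < j" for i j
  proof -
    have "1 / \<sigma> i j \<le> R j"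
      unfolding R_def by (rule member_le_sum) (use that in \<open>auto simp: \<sigma>_def\<close>)
    then show ?thesis using \<sigma>[of i j] that by (simp add: field_simps)
  qed
  \<comment> \<open>The sign is reversed for negative times, because there it is the inverse motion
    that has to approach \<open>c' j\<close>.\<close>
  define h where "h j u x = unit_ramp u * ((c j - x) * (1 - x\<^sup>2)) - unit_ramp (- u) * ((c' j - x) * (1 - x\<^sup>2))" for j u x
  \<comment> \<open>The extra factor \<open>(1/2)^6\<close> brings the Lipschitz constant 12 of
    \<open>h\<close> below 1/4, so that the whole series has Lipschitz constant at most 1/2.\<close>
  define F where "F j u x = (1/2)^(j+6) * (comb (R j) (t j) u * h j u x)" for j u x
  define E where "E u x = (\<Sum>j. F j u x)" for u x
  have ramp: "0 \<le> unit_ramp u" "unit_ramp u \<le> 1" for u by (auto simp: unit_ramp_def)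
  have h_bound: "\<bar>h j u x\<bar> \<le> 4" if "\<bar>x\<bar> \<le> 1" for j u x
  proof -
    have "\<bar>unit_ramp u * ((c j - x) * (1 - x\<^sup>2))\<bar> \<le> 1 * 2"
         "\<bar>unit_ramp (- u) * ((c' j - x) * (1 - x\<^sup>2))\<bar> \<le> 1 * 2"
      unfolding abs_mult[of "unit_ramp _"] using drift_bound that ramp c c'
      by (intro mult_mono; simp add: less_imp_le)+
    then show ?thesis unfolding h_def by linarith
  qed
  have h_lip: "\<bar>h j u x - h j u y\<bar> \<le> 12 * \<bar>x - y\<bar>" if "\<bar>x\<bar> \<le> 1" "\<bar>y\<bar> \<le> 1" for j u x y
  proof -
    have "\<bar>unit_ramp u * ((c j - x) * (1 - x\<^sup>2) - (c j - y) * (1 - y\<^sup>2))\<bar> \<le> 1 * (6 * \<bar>x - y\<bar>)"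
         "\<bar>unit_ramp (- u) * ((c' j - x) * (1 - x\<^sup>2) - (c' j - y) * (1 - y\<^sup>2))\<bar> \<le> 1 * (6 * \<bar>x - y\<bar>)"
      unfolding abs_mult[of "unit_ramp _"] using drift_lipschitz that ramp c c'
      by (intro mult_mono; simp add: less_imp_le)+
    then show ?thesis unfolding h_def right_diff_distrib[of "unit_ramp _"] by linarith
  qed
  have comb: "0 \<le> comb (R j) (t j) u" "comb (R j) (t j) u \<le> 1" for j u
    using comb_bounds R0 by auto
  have F_bound: "\<bar>F j u x\<bar> \<le> (1/2)^j * (1/8)" if "\<bar>x\<bar> \<le> 1" for j u x
  proof -
    have "\<bar>comb (R j) (t j) u * h j u x\<bar> \<le> 1 * 4"
      unfolding abs_mult using comb h_bound that by (intro mult_mono) auto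
    then have "\<bar>F j u x\<bar> \<le> (1/2)^(j+6) * 4"
      unfolding F_def abs_mult[of "(1/2)^_"] by (auto intro: mult_left_mono)
    then show ?thesis by (simp add: power_add power_divide)
  qed
  have F_lip: "\<bar>F j u x - F j u y\<bar> \<le> (1/2)^j * (\<bar>x - y\<bar> / 4)" if "\<bar>x\<bar> \<le> 1" "\<bar>y\<bar> \<le> 1" for j u x y
  proof -
    have "\<bar>comb (R j) (t j) u * (h j u x - h j u y)\<bar> \<le> 1 * (12 * \<bar>x - y\<bar>)"
      unfolding abs_mult using comb h_lip that by (intro mult_mono) auto
    then have "(1/2)^(j+6) * \<bar>comb (R j) (t j) u * (h j u x - h j u y)\<bar> \<le> (1/2)^(j+6) * (12 * \<bar>x - y\<bar>)"
      by (auto intro: mult_left_mono)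
    also have "(1/2)^(j+6) * \<bar>comb (R j) (t j) u * (h j u x - h j u y)\<bar> = \<bar>F j u x - F j u y\<bar>"
      unfolding F_def by (simp add: abs_mult right_diff_distrib[symmetric])
    also have "(1/2)^(j+6) * (12 * \<bar>x - y\<bar>) \<le> (1/2)^j * (\<bar>x - y\<bar> / 4)"
      by (simp add: power_add power_divide divide_simps)
    finally show ?thesis .
  qed
  have geom: "summable (\<lambda>j. (1/2)^j * (a::real))" "(\<Sum>j. (1/2)^j * a) = 2 * a" for a :: real
    using sums_mult2[OF geometric_sums[of "1/2::real"], of a] by (auto simp: sums_iff)
  have sumF: "summable (\<lambda>j. F j u x)" if "\<bar>x\<bar> \<le> 1" for u x
    by (rule summable_comparison_test'[OF geom(1)[of "1/8"]]) (use F_bound that in auto)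
  show ?thesis
  proof
    have "uniform_limit (UNIV \<times> {-1..1}) (\<lambda>n z. \<Sum>j<n. F j (fst z) (snd z)) (\<lambda>z. \<Sum>j. F j (fst z) (snd z)) sequentially"
      by (rule Weierstrass_m_test[OF _ geom(1)[of "1/8"]]) (use F_bound in auto)
    then have "continuous_on (UNIV \<times> {-1..1}) (\<lambda>z. \<Sum>j. F j (fst z) (snd z))"
      by (rule uniform_limit_theorem[rotated])
        (auto simp: F_def h_def comb_def unit_ramp_def intro!: always_eventually continuous_intros)
    then show "continuous_on (UNIV \<times> {-1..1}) (\<lambda>(u, x). E u x)"
      by (simp add: E_def case_prod_beta')
  next
    fix u x :: real assume x: "\<bar>x\<bar> \<le> 1"
    have "\<bar>E u x\<bar> \<le> (\<Sum>j. (1/2)^j * (1/8))"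
      unfolding E_def real_norm_def[symmetric]
      by (rule norm_suminf_le) (use F_bound x geom in auto)
    then show "\<bar>E u x\<bar> \<le> 1" unfolding geom by simp
  next
    show "E u 1 = 0" "E u (-1) = 0" for u by (simp_all add: E_def F_def h_def)
  next
    fix u x y :: real assume xy: "\<bar>x\<bar> \<le> 1" "\<bar>y\<bar> \<le> 1"
    have "E u x - E u y = (\<Sum>j. F j u x - F j u y)"
      unfolding E_def by (rule suminf_diff) (use sumF xy in auto)
    moreover have "\<bar>\<Sum>j. F j u x - F j u y\<bar> \<le> (\<Sum>j. (1/2)^j * (\<bar>x - y\<bar> / 4))"
      unfolding real_norm_def[symmetric]
      by (rule norm_suminf_le) (use F_lip xy geom in auto)
    ultimately show "\<bar>E u x - E u y\<bar> \<le> \<bar>x - y\<bar> / 2" unfolding geom by simp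
  next
    fix j
    define \<eta> :: real where "\<eta> = (1/2)^(j+6)"
    have \<eta>: "\<eta> > 0" "\<eta> \<le> 1" unfolding \<eta>_def by (auto simp: power_le_one)
    \<comment> \<open>For \<open>\<bar>k\<bar>\<close> beyond \<open>K0\<close>, the time
      \<open>t j + k\<close> is so large in absolute value that all combs with index below
      \<open>j\<close> vanish. The summand 1 also puts both times \<open>t j \<plusminus> k\<close>
      where the ramps are constant.\<close>
    define K0 where "K0 = (\<Sum>i<j. 1 / \<sigma> j i) + \<bar>t j\<bar> + 1"
    obtain K :: nat where K: "K0 \<le> real K" using real_arch_simple by blast
    have zero: "comb (R i) (t i) (t j + of_int k) = 0" if "i \<noteq> j" "K0 \<le> \<bar>of_int k\<bar>" for i k
    proof (rule comb_eq_0)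
      have "1 \<le> \<sigma> j i * (R i + \<bar>t j + of_int k\<bar>)"
      proof (cases "i < j")
        case True
        have "1 / \<sigma> j i \<le> (\<Sum>i<j. 1 / \<sigma> j i)"
          by (rule member_le_sum) (use True in \<open>auto simp: \<sigma>_def\<close>)
        then have "1 / \<sigma> j i \<le> R i + \<bar>t j + of_int k\<bar>"
          using that(2) R0[of i] unfolding K0_def by linarith
        then show ?thesis using \<sigma>[of j i] that by (simp add: field_simps)
      next
        case False
        then have "1 \<le> \<sigma> j i * R i" using R[of j i] that by auto
        also have "\<dots> \<le> \<sigma> j i * (R i + \<bar>t j + of_int k\<bar>)"
          by (intro mult_left_mono) (auto simp: \<sigma>_def)
        finally show ?thesis .
      qed
      then show "1 \<le> \<bar>sin (pi * (t j - t i))\<bar> * (R i + \<bar>t j + of_int k\<bar>)" by (simp add: \<sigma>_def)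
    qed
    have Ej: "E (t j + of_int k) x = \<eta> * h j (t j + of_int k) x" if "K0 \<le> \<bar>of_int k\<bar>" for k x
    proof -
      have "E (t j + of_int k) x = (\<Sum>i\<in>{j}. F i (t j + of_int k) x)"
        unfolding E_def by (rule suminf_finite) (use zero that in \<open>auto simp: F_def\<close>)
      then show ?thesis by (simp add: F_def comb_eq_1 \<eta>_def)
    qed
    have "E (t j + real k) x = \<eta> * ((c j - x) * (1 - x\<^sup>2)) \<and>
        E (t j - real k) x = - \<eta> * ((c' j - x) * (1 - x\<^sup>2))" if "k \<ge> K" for k x
    proof -
      have k: "K0 \<le> real k" using K that by linarith
      have "0 \<le> (\<Sum>i<j. 1 / \<sigma> j i)" by (intro sum_nonneg) (auto simp: \<sigma>_def)
      then have "1 \<le> t j + real k" "t j - real k \<le> -1" using k unfolding K0_def by linarith+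
      then have "h j (t j + real k) x = (c j - x) * (1 - x\<^sup>2)"
                "h j (t j - real k) x = - ((c' j - x) * (1 - x\<^sup>2))"
        by (simp_all add: h_def unit_ramp_def)
      then show ?thesis using Ej[of "int k" x] Ej[of "- int k" x] k by simp
    qed
    with \<eta> show "\<exists>\<eta>>0. \<eta> \<le> 1 \<and> (\<exists>K. \<forall>k\<ge>K. \<forall>x. E (t j + real k) x = \<eta> * ((c j - x) * (1 - x\<^sup>2)) \<and>
        E (t j - real k) x = - \<eta> * ((c' j - x) * (1 - x\<^sup>2)))" by blast
  qed
qed

section \<open>The model homeomorphism of the square\<close>

abbreviation (input) sq :: "(real \<times> real) set" where
  "sq \<equiv> {-1..1} \<times> {-1..1}"

lemma mem_sq: "z \<in> sq \<longleftrightarrow> \<bar>fst z\<bar> \<le> 1 \<and> \<bar>snd z\<bar> \<le> 1"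
  by (cases z) auto

lemma compact_sq: "compact sq"
  by (intro compact_Times compact_Icc)

text \<open>Away from the edges this is a composition. At the edges, where \<open>to_line\<close> is
  singular, boundedness of \<open>E\<close> lets the weight \<open>1 - \<bar>snd z\<bar>\<close>
  force the limit 0.\<close>

lemma continuous_on_drift:
  fixes E :: "real \<Rightarrow> real \<Rightarrow> real"
  assumes cont: "continuous_on (UNIV \<times> {-1..1}) (\<lambda>(u, x). E u x)"
    and bound: "\<And>u x. \<bar>x\<bar> \<le> 1 \<Longrightarrow> \<bar>E u x\<bar> \<le> 1"
  shows "continuous_on sq (\<lambda>z. (1 - \<bar>snd z\<bar>) * E (to_line (snd z)) (fst z))"
proof -
  let ?D = "\<lambda>z. (1 - \<bar>snd z\<bar>) * E (to_line (snd z)) (fst z)"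
  have "((\<lambda>z. ?D z) \<longlongrightarrow> ?D z) (at z within sq)" if z: "z \<in> sq" for z
  proof (cases "\<bar>snd z\<bar> < 1")
    case True
    let ?U = "{-1..1} \<times> {-1<..<1::real}"
    have "continuous_on ?U (\<lambda>z. (\<lambda>(u, x). E u x) (to_line (snd z), fst z))"
      by (rule continuous_on_compose2[OF cont])
        (auto simp: to_line_def intro!: continuous_intros)
    then have "continuous_on ?U ?D" by (auto intro!: continuous_intros)
    then have "(?D \<longlongrightarrow> ?D z) (at z within ?U)"
      unfolding continuous_on_def
      by (rule bspec) (use True z in \<open>auto simp: mem_sq abs_less_iff mem_Times_iff\<close>)
    moreover have "at z within sq = at z within ?U"
      by (rule at_within_nhd[of _ "UNIV \<times> {-1<..<1}"])
        (use True in \<open>auto intro: open_Times\<close>, cases z, auto)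
    ultimately show ?thesis by simp
  next
    case False
    then have e: "1 - \<bar>snd z\<bar> = 0" using z by (simp add: mem_sq)
    have "((\<lambda>z. ?D z) \<longlongrightarrow> 0) (at z within sq)"
    proof (rule Lim_null_comparison)
      show "\<forall>\<^sub>F z in at z within sq. norm (?D z) \<le> 1 - \<bar>snd z\<bar>"
        unfolding eventually_at_filter
      proof (intro always_eventually allI impI)
        fix y assume "y \<in> sq"
        then have y: "\<bar>fst y\<bar> \<le> 1" "0 \<le> 1 - \<bar>snd y\<bar>" by (auto simp: mem_sq)
        have "(1 - \<bar>snd y\<bar>) * \<bar>E (to_line (snd y)) (fst y)\<bar> \<le> (1 - \<bar>snd y\<bar>) * 1"
          using y bound by (intro mult_left_mono) auto
        then show "norm (?D y) \<le> 1 - \<bar>snd y\<bar>" using y by (simp add: abs_mult)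
      qed
      have "((\<lambda>z. 1 - \<bar>snd z\<bar>) \<longlongrightarrow> 1 - \<bar>snd z\<bar>) (at z within sq)"
        by (intro tendsto_intros)
      then show "((\<lambda>z. 1 - \<bar>snd z\<bar>) \<longlongrightarrow> 0) (at z within sq)" using e by simp
    qed
    then show ?thesis using e by simp
  qed
  then show ?thesis by (simp add: continuous_on_def)
qed

text \<open>On each horizontal line, \<open>\<Psi>\<close> pushes by the weighted drift and then
  advances the time \<open>to_line s\<close> by 1. The orbit of \<open>(x j, s j)\<close> runs
  through the times \<open>to_line (s j) + \<int>\<close>, on which the drift eventually pulls only
  towards \<open>c j\<close>, respectively \<open>c' j\<close>.\<close>

lemma model_homeomorphism:
  fixes x s c c' :: "nat \<Rightarrow> real"
  assumes x: "\<And>j. \<bar>x j\<bar> < 1" and s: "\<And>j. \<bar>s j\<bar> < 1"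
    and s_mod: "\<And>i j k. i \<noteq> j \<Longrightarrow> to_line (s i) - to_line (s j) \<noteq> of_int k"
    and c: "\<And>j. \<bar>c j\<bar> < 1" and c': "\<And>j. \<bar>c' j\<bar> < 1"
  obtains \<Psi> \<Psi>' where "homeomorphism sq sq \<Psi> \<Psi>'"
    "\<And>z. z \<in> sq \<Longrightarrow> snd (\<Psi> z) = line_affine 1 1 (snd z)"
    "\<And>z. z \<in> sq \<Longrightarrow> \<bar>snd z\<bar> = 1 \<Longrightarrow> \<Psi> z = z"
    "\<And>j. (\<lambda>k. (\<Psi>^^k) (x j, s j)) \<longlonglongrightarrow> (c j, 1)"
    "\<And>j. (\<lambda>k. (\<Psi>'^^k) (x j, s j)) \<longlonglongrightarrow> (c' j, -1)"
proof -
  obtain E where E: "continuous_on (UNIV \<times> {-1..1}) (\<lambda>(u, x). E u x)"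
    "\<And>u x. \<bar>x\<bar> \<le> 1 \<Longrightarrow> \<bar>E u x\<bar> \<le> 1"
    "\<And>u. E u 1 = 0" "\<And>u. E u (-1) = 0"
    and E_lip: "\<And>u x y. \<bar>x\<bar> \<le> 1 \<Longrightarrow> \<bar>y\<bar> \<le> 1 \<Longrightarrow> \<bar>E u x - E u y\<bar> \<le> \<bar>x - y\<bar> / 2"
    and E_orbit: "\<And>j. \<exists>\<eta>>0. \<eta> \<le> 1 \<and> (\<exists>K. \<forall>k\<ge>K. \<forall>x.
        E (to_line (s j) + real k) x = \<eta> * ((c j - x) * (1 - x\<^sup>2)) \<and>
        E (to_line (s j) - real k) x = - \<eta> * ((c' j - x) * (1 - x\<^sup>2)))"
    by (rule drift_field_exists[OF s_mod c c']) (assumption, rule that)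
  define g where "g r y = y + (1 - \<bar>r\<bar>) * E (to_line r) y" for r y
  define \<Psi> where "\<Psi> z = (g (snd z) (fst z), line_affine 1 1 (snd z))" for z
  \<comment> \<open>Since \<open>g r\<close> differs from the identity by a map with Lipschitz
    constant 1/2 and fixes \<plusminus>1, it is injective and preserves [-1, 1] and its
    interior.\<close>
  have g_lip: "\<bar>(g r y - y) - (g r y' - y')\<bar> \<le> \<bar>y - y'\<bar> / 2"
    if "\<bar>r\<bar> \<le> 1" "\<bar>y\<bar> \<le> 1" "\<bar>y'\<bar> \<le> 1" for r y y'
  proof -
    have "(1 - \<bar>r\<bar>) * \<bar>E (to_line r) y - E (to_line r) y'\<bar> \<le> 1 * (\<bar>y - y'\<bar> / 2)"
      using that E_lip by (intro mult_mono) auto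
    then show ?thesis using that by (simp add: g_def right_diff_distrib[symmetric] abs_mult)
  qed
  have g_end: "g r 1 = 1" "g r (-1) = -1" for r by (simp_all add: g_def E)
  have g_less: "\<bar>g r y\<bar> < 1" if "\<bar>r\<bar> \<le> 1" "\<bar>y\<bar> < 1" for r y
    using g_lip[of r y 1] g_lip[of r y "-1"] that g_end[of r] by (simp add: abs_if split: if_splits)
  have g_le: "\<bar>g r y\<bar> \<le> 1" if "\<bar>r\<bar> \<le> 1" "\<bar>y\<bar> \<le> 1" for r y
    using g_less[of r y] that g_end[of r] by (cases "\<bar>y\<bar> = 1") (auto simp: abs_if split: if_splits)
  have cont: "continuous_on sq \<Psi>"
    unfolding \<Psi>_def g_def
    by (intro continuous_intros continuous_on_drift E continuous_on_line_affine) (auto simp: mem_sq)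
  have \<Psi>_sq: "\<Psi> z \<in> sq" if "z \<in> sq" for z
    using that g_le abs_line_affine_le by (simp add: mem_sq \<Psi>_def)
  have inv: "line_affine 1 (-1) (line_affine 1 1 r) = r" "line_affine 1 1 (line_affine 1 (-1) r) = r"
    if "\<bar>r\<bar> \<le> 1" for r
    using line_affine_inverse[of 1 r 1] that by simp_all
  have inj: "inj_on \<Psi> sq"
  proof (rule inj_onI)
    fix z z' assume z: "z \<in> sq" "z' \<in> sq" "\<Psi> z = \<Psi> z'"
    have "line_affine 1 (-1) (line_affine 1 1 (snd z)) = line_affine 1 (-1) (line_affine 1 1 (snd z'))"
      using z(3) by (simp add: \<Psi>_def)
    then have snd: "snd z = snd z'" using z(1,2) by (simp add: inv(1) mem_sq)
    have "g (snd z) (fst z) = g (snd z) (fst z')" using z snd by (simp add: \<Psi>_def)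
    then have "fst z = fst z'"
      using g_lip[of "snd z" "fst z" "fst z'"] z(1,2) by (simp add: mem_sq abs_minus_commute)
    with snd show "z = z'" by (simp add: prod_eq_iff)
  qed
  have surj: "\<Psi> ` sq = sq"
  proof (intro equalityI image_subsetI \<Psi>_sq subsetI)
    fix z assume z: "z \<in> sq"
    let ?r = "line_affine 1 (-1) (snd z)"
    have r: "\<bar>?r\<bar> \<le> 1" using z abs_line_affine_le by (simp add: mem_sq)
    have "continuous_on {-1..1} (\<lambda>y. fst (\<Psi> (y, ?r)))"
      by (rule continuous_on_compose2[OF continuous_on_fst[OF cont]])
        (use r in \<open>auto intro!: continuous_intros\<close>)
    then have "continuous_on {-1..1} (g ?r)" by (simp add: \<Psi>_def)
    then obtain y where "-1 \<le> y" "y \<le> 1" "g ?r y = fst z"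
      using IVT'[of "g ?r" "-1" "fst z" 1] g_end z by (auto simp: mem_sq abs_le_iff)
    then show "z \<in> \<Psi> ` sq"
      using r inv(2)[of "snd z"] z by (intro image_eqI[of _ _ "(y, ?r)"]) (auto simp: \<Psi>_def mem_sq)
  qed
  obtain \<Psi>' where hom: "homeomorphism sq sq \<Psi> \<Psi>'"
    using homeomorphism_compact[OF compact_sq cont surj inj] by blast
  have \<Psi>'_sq: "\<Psi>' z \<in> sq" and \<Psi>\<Psi>': "\<Psi> (\<Psi>' z) = z" if "z \<in> sq" for z
    using hom that unfolding homeomorphism_def by blast+
  show ?thesis
  proof
    show "homeomorphism sq sq \<Psi> \<Psi>'" by (rule hom)
    show "snd (\<Psi> z) = line_affine 1 1 (snd z)" for z by (simp add: \<Psi>_def)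
    show "\<Psi> z = z" if "\<bar>snd z\<bar> = 1" for z
      using that by (simp add: \<Psi>_def g_def line_affine_end prod_eq_iff)
  next
    fix j
    let ?t = "to_line (s j)"
    obtain \<eta> K where \<eta>: "\<eta> > 0" "\<eta> \<le> 1" and
      K: "\<And>k x. k \<ge> K \<Longrightarrow> E (?t + real k) x = \<eta> * ((c j - x) * (1 - x\<^sup>2))"
         "\<And>k x. k \<ge> K \<Longrightarrow> E (?t - real k) x = - \<eta> * ((c' j - x) * (1 - x\<^sup>2))"
      using E_orbit[of j] by blast
    \<comment> \<open>\<open>real n + L\<close> dominates the denominators
      \<open>1 + \<bar>u\<bar>\<close> of both orbits; the backward one is evaluated at index
      \<open>Suc n\<close>, hence the 2.\<close>
    define L where "L = 2 + \<bar>?t\<bar> + real K"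
    have \<theta>: "0 \<le> \<eta> / (1 + \<bar>u\<bar>)" "\<eta> / (1 + \<bar>u\<bar>) \<le> 1" for u :: real
      using \<eta> by (auto simp: field_simps)
    define X where "X k = fst ((\<Psi>^^k) (x j, s j))" for k
    have orbit: "(\<Psi>^^k) (x j, s j) = (X k, from_line (?t + real k)) \<and> \<bar>X k\<bar> < 1" for k
    proof (induction k)
      case 0 then show ?case using s x by (simp add: X_def)
    next
      case (Suc k)
      then have e: "(\<Psi>^^Suc k) (x j, s j) = (g (from_line (?t + real k)) (X k), from_line (?t + real (Suc k)))"
        using \<Psi>_def[of "(\<Psi>^^k) (x j, s j)"] by (simp add: line_affine_eq add_ac)
      then have "X (Suc k) = g (from_line (?t + real k)) (X k)" by (simp add: X_def)
      with e Suc show ?case using g_less[of "from_line (?t + real k)" "X k"] by (simp add: less_imp_le)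
    qed
    have X_step: "X (Suc k) = X k + E (?t + real k) (X k) / (1 + \<bar>?t + real k\<bar>)" for k
    proof -
      have "X (Suc k) = fst (\<Psi> (X k, from_line (?t + real k)))" using orbit[of k] by (simp add: X_def)
      then show ?thesis by (simp add: \<Psi>_def g_def one_minus_abs_from_line)
    qed
    have "(\<lambda>n. X (n + K)) \<longlonglongrightarrow> c j"
    proof (rule contracting_sequence_tendsto)
      fix n
      define th where "th = \<eta> / (1 + \<bar>?t + real (n + K)\<bar>)"
      let ?\<theta> = th
      let ?a = "1 - ?\<theta> * (1 - (X (n + K))\<^sup>2)"
      have th: "0 \<le> th" "th \<le> 1" unfolding th_def by (rule \<theta>)+
      have q: "0 \<le> 1 - (X (n + K))\<^sup>2" "1 - (X (n + K))\<^sup>2 \<le> 1"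
        using orbit[of "n + K"] by (auto simp: abs_square_le_1)
      have "X (Suc n + K) = X (n + K) + ?\<theta> * ((c j - X (n + K)) * (1 - (X (n + K))\<^sup>2))"
        using X_step[of "n + K"] K(1)[of "n + K"] by (simp add: th_def)
      then show "X (Suc n + K) - c j = ?a * (X (n + K) - c j)" by (simp add: algebra_simps)
      have p: "0 \<le> ?\<theta> * (1 - (X (n + K))\<^sup>2)" "?\<theta> * (1 - (X (n + K))\<^sup>2) \<le> 1"
        using th q by (auto intro: mult_nonneg_nonneg mult_le_one)
      then show a: "0 \<le> ?a" "?a \<le> 1" by auto
      have "\<eta> / (real n + L) \<le> ?\<theta>"
        unfolding th_def using \<eta> by (intro divide_left_mono) (auto simp: L_def)
      then have "\<eta> / (real n + L) * (1 - (X (n + K))\<^sup>2) * ?a \<le> ?\<theta> * (1 - (X (n + K))\<^sup>2) * 1"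
        using a q p th by (intro mult_mono) (auto simp: L_def \<eta>(1) less_imp_le)
      then show "\<eta> / (real n + L) * (1 - (X (n + K))\<^sup>2) * ?a \<le> 1 - ?a \<or>
         \<eta> / (real n + L) * (1 - (X (Suc n + K))\<^sup>2) * ?a \<le> 1 - ?a" by simp
    qed (use orbit[of K] c \<eta> in \<open>auto simp: L_def\<close>)
    then have X_lim: "X \<longlonglongrightarrow> c j" by (rule LIMSEQ_offset)
    have "(\<lambda>k. from_line (?t + real k)) \<longlonglongrightarrow> 1"
      by (rule filterlim_compose[OF from_line_at_top]) real_asymp
    with X_lim show "(\<lambda>k. (\<Psi>^^k) (x j, s j)) \<longlonglongrightarrow> (c j, 1)"
      using orbit by (simp add: tendsto_Pair)
    define Y where "Y k = fst ((\<Psi>'^^k) (x j, s j))" for k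
    \<comment> \<open>The inverse has no formula here; its orbit is described by the implicit
      equation that \<open>\<Psi>\<close> sends the new point to the old one, with the drift
      evaluated at the new point \<open>Y k\<close>.\<close>
    have orbit': "(\<Psi>'^^k) (x j, s j) = (Y k, from_line (?t - real k)) \<and> \<bar>Y k\<bar> < 1 \<and>
        (k > 0 \<longrightarrow> Y (k - 1) = Y k + E (?t - real k) (Y k) / (1 + \<bar>?t - real k\<bar>))" for k
    proof (induction k)
      case 0 then show ?case using s x by (simp add: Y_def)
    next
      case (Suc k)
      let ?z = "(\<Psi>'^^Suc k) (x j, s j)"
      have zk: "(\<Psi>'^^k) (x j, s j) \<in> sq" using Suc by (simp add: mem_sq less_imp_le)
      have z: "?z \<in> sq" using \<Psi>'_sq[OF zk] by simp
      have \<Psi>z: "\<Psi> ?z = (Y k, from_line (?t - real k))" using \<Psi>\<Psi>'[OF zk] Suc by simp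
      then have "line_affine 1 1 (snd ?z) = from_line (?t - real k)" by (simp add: \<Psi>_def)
      then have "snd ?z = line_affine 1 (-1) (from_line (?t - real k))"
        using inv(1)[of "snd ?z"] z by (simp add: mem_sq)
      then have sz: "snd ?z = from_line (?t - real (Suc k))"
        by (simp add: line_affine_eq algebra_simps)
      have gz: "Y k = g (from_line (?t - real (Suc k))) (Y (Suc k))"
        using \<Psi>z sz by (simp add: \<Psi>_def Y_def)
      have "\<bar>Y (Suc k)\<bar> \<le> 1" using z by (simp add: mem_sq Y_def)
      moreover have "\<bar>Y (Suc k)\<bar> \<noteq> 1" using gz g_end Suc by (auto simp: abs_if split: if_splits)
      ultimately show ?case using sz gz
        by (auto simp: Y_def[symmetric] g_def one_minus_abs_from_line prod_eq_iff simp del: funpow.simps)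
    qed
    have "(\<lambda>n. Y (n + K)) \<longlonglongrightarrow> c' j"
    proof (rule contracting_sequence_tendsto)
      fix n
      let ?y = "Y (Suc n + K)"
      define th where "th = \<eta> / (1 + \<bar>?t - real (Suc n + K)\<bar>)"
      let ?\<theta> = th
      \<comment> \<open>Solving the implicit equation for the distance of the new point from
        \<open>c' j\<close> gives this contraction factor.\<close>
      let ?a = "1 / (1 + ?\<theta> * (1 - ?y\<^sup>2))"
      have th: "0 \<le> th" "th \<le> 1" unfolding th_def by (rule \<theta>)+
      have q: "0 \<le> 1 - ?y\<^sup>2"
        using orbit'[of "Suc n + K"] by (auto simp: abs_square_le_1)
      have p: "0 \<le> ?\<theta> * (1 - ?y\<^sup>2)" using th q by (intro mult_nonneg_nonneg)
      have "Y (n + K) = ?y - ?\<theta> * ((c' j - ?y) * (1 - ?y\<^sup>2))"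
        using orbit'[of "Suc n + K"] K(2)[of "Suc n + K"] by (simp add: th_def)
      then have "Y (n + K) - c' j = (1 + ?\<theta> * (1 - ?y\<^sup>2)) * (?y - c' j)"
        by (simp add: algebra_simps)
      then show "?y - c' j = ?a * (Y (n + K) - c' j)" using p by simp
      show a: "0 \<le> ?a" "?a \<le> 1" using p by auto
      have "\<eta> / (real n + L) \<le> ?\<theta>"
        unfolding th_def using \<eta> by (intro divide_left_mono) (auto simp: L_def)
      then have "\<eta> / (real n + L) * (1 - ?y\<^sup>2) * ?a \<le> ?\<theta> * (1 - ?y\<^sup>2) * ?a"
        using a q by (intro mult_right_mono) auto
      also have "\<dots> = 1 - ?a" using p by (simp add: divide_simps)
      finally show "\<eta> / (real n + L) * (1 - (Y (n + K))\<^sup>2) * ?a \<le> 1 - ?a \<or>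
         \<eta> / (real n + L) * (1 - ?y\<^sup>2) * ?a \<le> 1 - ?a" by simp
    qed (use orbit'[of K] c' \<eta> in \<open>auto simp: L_def\<close>)
    then have Y_lim: "Y \<longlonglongrightarrow> c' j" by (rule LIMSEQ_offset)
    have "(\<lambda>k. from_line (?t - real k)) \<longlonglongrightarrow> -1"
      by (rule filterlim_compose[OF from_line_at_bot]) real_asymp
    with Y_lim show "(\<lambda>k. (\<Psi>'^^k) (x j, s j)) \<longlonglongrightarrow> (c' j, -1)"
      using orbit' by (simp add: tendsto_Pair)
  qed
qed

section \<open>Factors of the model\<close>

text \<open>A continuous map from a compact space to a Hausdorff space is closed, so the preimage of
  a closed set under \<open>f\<close> is the image under \<open>P\<close> of a compact set.\<close>

lemma continuous_on_compact_quotient: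
  fixes P :: "'a::t2_space \<Rightarrow> 'b::t2_space" and f :: "'b \<Rightarrow> 'c::topological_space"
  assumes S: "compact S" and P: "continuous_on S P" and f: "continuous_on S (\<lambda>x. f (P x))"
  shows "continuous_on (P ` S) f"
  unfolding continuous_on_closed_vimage[OF compact_imp_closed[OF compact_continuous_image[OF P S]]]
proof (intro allI impI)
  fix B :: "'c set" assume "closed B"
  then have "closed ((\<lambda>x. f (P x)) -` B \<inter> S)"
    using f compact_imp_closed[OF S] by (simp add: continuous_on_closed_vimage)
  then have "compact ((\<lambda>x. f (P x)) -` B \<inter> S)"
    using compact_Int_closed[OF S] by (metis Int_assoc Int_commute inf.idem)
  then have "compact (P ` ((\<lambda>x. f (P x)) -` B \<inter> S))"
    by (rule compact_continuous_image[rotated]) (use P in \<open>auto intro: continuous_on_subset\<close>)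
  moreover have "P ` ((\<lambda>x. f (P x)) -` B \<inter> S) = f -` B \<inter> P ` S" by auto
  ultimately show "closed (f -` B \<inter> P ` S)" by (simp add: compact_imp_closed)
qed

text \<open>Both \<open>\<Psi>\<close> and its inverse respect the fibres of \<open>P\<close>, so
  the induced maps can be computed at any chosen preimage; they are continuous because
  \<open>P\<close> is a quotient map onto its image.\<close>

lemma homeomorphism_quotient:
  fixes P :: "'a::t2_space \<Rightarrow> 'b::t2_space"
  assumes S: "compact S" and P: "continuous_on S P" "P ` S = T"
    and hom: "homeomorphism S S \<Psi> \<Psi>'"
    and comp: "\<And>u v. \<lbrakk>u \<in> S; v \<in> S; P u = P v\<rbrakk> \<Longrightarrow> P (\<Psi> u) = P (\<Psi> v) \<and> P (\<Psi>' u) = P (\<Psi>' v)"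
  obtains \<psi> \<psi>' where "homeomorphism T T \<psi> \<psi>'"
    "\<And>u. u \<in> S \<Longrightarrow> \<psi> (P u) = P (\<Psi> u)" "\<And>u. u \<in> S \<Longrightarrow> \<psi>' (P u) = P (\<Psi>' u)"
proof -
  define \<psi> where "\<psi> z = P (\<Psi> (inv_into S P z))" for z
  define \<psi>' where "\<psi>' z = P (\<Psi>' (inv_into S P z))" for z
  have i: "inv_into S P (P u) \<in> S" "P (inv_into S P (P u)) = P u" if "u \<in> S" for u
    using that by (simp_all add: inv_into_into f_inv_into_f)
  have 1: "\<psi> (P u) = P (\<Psi> u)" "\<psi>' (P u) = P (\<Psi>' u)" if "u \<in> S" for u
    using comp[OF i(1)[OF that] that i(2)[OF that]] by (simp_all add: \<psi>_def \<psi>'_def)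
  have H: "continuous_on S \<Psi>" "continuous_on S \<Psi>'" "\<Psi> ` S = S" "\<Psi>' ` S = S"
    "\<And>x. x \<in> S \<Longrightarrow> \<Psi>' (\<Psi> x) = x" "\<And>x. x \<in> S \<Longrightarrow> \<Psi> (\<Psi>' x) = x"
    using hom by (auto simp: homeomorphism_def)
  then have mem: "\<Psi> u \<in> S" "\<Psi>' u \<in> S" if "u \<in> S" for u using that by blast+
  have "continuous_on T \<psi>" "continuous_on T \<psi>'"
    unfolding P(2)[symmetric]
    by (rule continuous_on_compact_quotient[OF S P(1)],
        subst continuous_on_cong[OF refl 1(1)] continuous_on_cong[OF refl 1(2)], assumption,
        rule continuous_on_compose2[OF P(1)], auto simp: H mem)+
  moreover have "\<psi> z \<in> T" "\<psi>' z \<in> T" "\<psi>' (\<psi> z) = z" "\<psi> (\<psi>' z) = z" if z: "z \<in> T" for z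
    using z 1 mem H by (auto simp: P(2)[symmetric])
  ultimately have "homeomorphism T T \<psi> \<psi>'" by (intro homeomorphismI) auto
  with 1 show ?thesis using that by blast
qed

section \<open>Entropy and limit sets of a factor\<close>

lemma card_nat_window_le: "card {k. k < n \<and> \<bar>t + real k\<bar> < a} \<le> nat \<lceil>2 * a\<rceil> + 1"
proof -
  let ?K = "{k. k < n \<and> \<bar>t + real k\<bar> < a}"
  show ?thesis
  proof (cases "?K = {}")
    case False
    define m where "m = Min ?K"
    have m: "m \<in> ?K" unfolding m_def using False by (intro Min_in) auto
    have "?K \<subseteq> {m..m + nat \<lceil>2 * a\<rceil>}"
    proof
      fix k assume k: "k \<in> ?K"
      then have "m \<le> k" unfolding m_def by (intro Min_le) auto
      moreover have "real k - real m \<le> 2 * a" using k m by auto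
      then have "k \<le> m + nat \<lceil>2 * a\<rceil>" by linarith
      ultimately show "k \<in> {m..m + nat \<lceil>2 * a\<rceil>}" by simp
    qed
    then have "card ?K \<le> card {m..m + nat \<lceil>2 * a\<rceil>}" by (intro card_mono) auto
    then show ?thesis by simp
  next
    case True
    then show ?thesis by (simp only: card.empty)
  qed
qed

text \<open>Points advance by 1 in the coordinate \<open>to_line (snd u)\<close>, and only points with this
  coordinate in a bounded interval move far.\<close>

lemma factor_entropy_0:
  fixes P :: "real \<times> real \<Rightarrow> real \<times> real"
  assumes P: "continuous_on sq P" "P ` sq = sq"
    and \<Psi>: "continuous_on sq \<Psi>" "\<Psi> ` sq \<subseteq> sq"
    and adv: "\<And>z. z \<in> sq \<Longrightarrow> snd (\<Psi> z) = line_affine 1 1 (snd z)"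
    and fixed: "\<And>z. z \<in> sq \<Longrightarrow> \<bar>snd z\<bar> = 1 \<Longrightarrow> \<Psi> z = z"
    and \<psi>: "\<And>u. u \<in> sq \<Longrightarrow> \<psi> (P u) = P (\<Psi> u)"
  shows "topological_entropy sq \<psi> = 0"
proof (rule topological_entropy_eq_0)
  show "\<psi> ` sq \<subseteq> sq"
  proof (rule image_subsetI)
    fix z assume "z \<in> sq"
    then obtain u where u: "u \<in> sq" "z = P u" using P(2) by blast
    then have "P (\<Psi> u) \<in> P ` sq" using \<Psi>(2) by blast
    then show "\<psi> z \<in> sq" using u \<psi>[OF u(1)] P(2) by simp
  qed
  fix \<delta> :: real assume \<delta>: "\<delta> > 0"
  \<comment> \<open>The displacement of \<open>\<psi>\<close>, read off upstairs, vanishes on the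
    edges, which \<open>\<Psi>\<close> fixes. By uniform continuity it is below \<delta> in a whole
    strip of width \<kappa> along them.\<close>
  let ?g = "\<lambda>u. dist (P (\<Psi> u)) (P u)"
  have "continuous_on sq ?g"
    by (intro continuous_on_dist continuous_on_compose2[OF P(1) \<Psi>(1)] P \<Psi>)
  then have "uniformly_continuous_on sq ?g"
    using compact_sq by (rule compact_uniformly_continuous)
  then obtain \<kappa> where \<kappa>: "\<kappa> > 0" "\<And>u v. \<lbrakk>u \<in> sq; v \<in> sq; dist v u < \<kappa>\<rbrakk> \<Longrightarrow> dist (?g v) (?g u) < \<delta>"
    unfolding uniformly_continuous_on_def using \<delta> by metis
  have slow: "?g u < \<delta>" if u: "u \<in> sq" and s: "1 - \<bar>snd u\<bar> < \<kappa>" for u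
  proof -
    define v where "v = (fst u, if snd u \<ge> 0 then 1 else -1 :: real)"
    have v: "v \<in> sq" "\<Psi> v = v" using u fixed[of v] by (auto simp: v_def mem_sq)
    have "dist v u < \<kappa>" using s u by (cases u) (auto simp: v_def dist_Pair_Pair dist_real_def)
    then have "dist (?g v) (?g u) < \<delta>" using \<kappa>(2)[OF u v(1)] by simp
    then show ?thesis using v by (simp add: dist_real_def)
  qed
  \<comment> \<open>Outside the strip the time satisfies
    \<open>\<bar>t\<bar> < 1 / \<kappa>\<close>, and an orbit that advances by 1 per step spends at
    most \<open>N\<close> steps there.\<close>
  define N where "N = nat \<lceil>2 * (1 / \<kappa>)\<rceil> + 1"
  have "card {k. k < n \<and> dist ((\<psi>^^Suc k) z) ((\<psi>^^k) z) \<ge> \<delta>} \<le> N" if z: "z \<in> sq" for z n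
  proof -
    obtain u where u: "u \<in> sq" "z = P u" using z P(2) by blast
    have U: "(\<Psi>^^k) u \<in> sq" for k using u \<Psi>(2) by (induction k) auto
    have it: "(\<psi>^^k) z = P ((\<Psi>^^k) u)" for k
      using u U \<psi> by (induction k) auto
    have bad: "\<bar>snd ((\<Psi>^^k) u)\<bar> \<le> 1 - \<kappa>" if "dist ((\<psi>^^Suc k) z) ((\<psi>^^k) z) \<ge> \<delta>" for k
      using slow[OF U[of k]] that it[of k] it[of "Suc k"] by fastforce
    show ?thesis
    proof (cases "\<bar>snd u\<bar> < 1")
      case True
      have orbit: "snd ((\<Psi>^^k) u) = from_line (to_line (snd u) + real k)" for k
      proof (induction k)
        case (Suc k)
        then show ?case using adv[OF U[of k]] by (simp add: line_affine_eq add_ac)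
      qed (use True in simp)
      have "\<bar>to_line (snd u) + real k\<bar> < 1 / \<kappa>" if "dist ((\<psi>^^Suc k) z) ((\<psi>^^k) z) \<ge> \<delta>" for k
      proof -
        have "\<kappa> \<le> 1 / (1 + \<bar>to_line (snd u) + real k\<bar>)"
          using bad[OF that] unfolding orbit one_minus_abs_from_line[symmetric] by linarith
        then have "\<kappa> * (1 + \<bar>to_line (snd u) + real k\<bar>) \<le> 1"
          by (simp add: pos_le_divide_eq add_pos_nonneg)
        then have "\<kappa> * \<bar>to_line (snd u) + real k\<bar> < 1" using \<kappa>(1) by (simp add: distrib_left)
        then show ?thesis using \<kappa>(1) by (simp add: pos_less_divide_eq mult.commute)
      qed
      then have "card {k. k < n \<and> dist ((\<psi>^^Suc k) z) ((\<psi>^^k) z) \<ge> \<delta>}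
         \<le> card {k. k < n \<and> \<bar>to_line (snd u) + real k\<bar> < 1 / \<kappa>}"
        by (intro card_mono) auto
      then show ?thesis using card_nat_window_le unfolding N_def by (meson le_trans)
    next
      case False
      then have "\<bar>snd u\<bar> = 1" using u by (simp add: mem_sq)
      then have "(\<Psi>^^k) u = u" for k using fixed[OF u(1)] by (induction k) auto
      then have "{k. k < n \<and> dist ((\<psi>^^Suc k) z) ((\<psi>^^k) z) \<ge> \<delta>} = {}"
        using \<delta> unfolding it by (auto simp del: funpow.simps)
      then show ?thesis by (simp only: card.empty)
    qed
  qed
  then show "\<exists>N. \<forall>z\<in>sq. \<forall>n. card {k. k < n \<and> dist ((\<psi>^^Suc k) z) ((\<psi>^^k) z) \<ge> \<delta>} \<le> N" by blast
qed (rule compact_sq)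

lemma omega_limit_eq:
  assumes "(\<lambda>k. (f^^k) x) \<longlonglongrightarrow> y" shows "omega_limit f x = {y}"
proof -
  have "(\<lambda>k. (f^^(r k)) x) \<longlonglongrightarrow> y" if "strict_mono r" for r :: "nat \<Rightarrow> nat"
    using LIMSEQ_subseq_LIMSEQ[OF assms that] by (simp add: o_def)
  then show ?thesis unfolding omega_limit_def
    by (auto intro: LIMSEQ_unique exI[of _ id] simp: assms strict_mono_def)
qed

lemma omega_limit_factor:
  assumes P: "continuous_on S P" and \<psi>: "\<And>u. u \<in> S \<Longrightarrow> \<psi> (P u) = P (\<Psi> u)" and "\<Psi> ` S \<subseteq> S"
    and q: "q \<in> S" "y \<in> S" "(\<lambda>k. (\<Psi>^^k) q) \<longlonglongrightarrow> y"
  shows "omega_limit \<psi> (P q) = {P y}"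
proof (rule omega_limit_eq)
  have S: "(\<Psi>^^k) q \<in> S" for k using assms by (induction k) auto
  have "(\<psi>^^k) (P q) = P ((\<Psi>^^k) q)" for k using S \<psi> by (induction k) auto
  moreover have "(\<lambda>k. P ((\<Psi>^^k) q)) \<longlonglongrightarrow> P y"
    by (rule continuous_on_tendsto_compose[OF P q(3,2)]) (simp add: S)
  ultimately show "(\<lambda>k. (\<psi>^^k) (P q)) \<longlonglongrightarrow> P y" by simp
qed

section \<open>Generic coordinates and descent of the model\<close>

text \<open>A generic map \<open>(x, t) \<mapsto> (x, \<mu> (t - l x))\<close> in the coordinate \<open>t = to_line s\<close>.\<close>

lemma exists_generic_coordinates:
  fixes q :: "nat \<Rightarrow> real \<times> real"
  assumes q: "inj q" "\<And>j. \<bar>fst (q j)\<bar> < 1" "\<And>j. \<bar>snd (q j)\<bar> < 1"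
  obtains \<Lambda> \<Lambda>' where "homeomorphism sq sq \<Lambda> \<Lambda>'"
    "\<And>z. fst (\<Lambda> z) = fst z" "\<And>z. z \<in> sq \<Longrightarrow> \<bar>snd (\<Lambda> z)\<bar> = 1 \<longleftrightarrow> \<bar>snd z\<bar> = 1"
    "\<And>z. \<bar>snd z\<bar> = 1 \<Longrightarrow> \<Lambda> z = z"
    "\<And>i j k. i \<noteq> j \<Longrightarrow> to_line (snd (\<Lambda>' (q i))) - to_line (snd (\<Lambda>' (q j))) \<noteq> of_int k"
    "\<And>j. fst (\<Lambda>' (q j)) = fst (q j)" "\<And>j. \<bar>snd (\<Lambda>' (q j))\<bar> < 1"
proof -
  define t where "t j = to_line (snd (q j))" for j
  \<comment> \<open>Avoiding these pairs makes the numbers \<open>t i - l * fst (q i)\<close>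
    pairwise distinct.\<close>
  let ?A = "{(t i - t j, fst (q j) - fst (q i)) | i j. i \<noteq> j}"
  have "?A \<subseteq> (\<lambda>(i, j). (t i - t j, fst (q j) - fst (q i))) ` UNIV" by auto
  then have "countable ?A" by (rule countable_subset) simp
  moreover have "(0, 0) \<notin> ?A"
  proof
    assume "(0, 0) \<in> ?A"
    then obtain i j where ij: "i \<noteq> j" "t i = t j" "fst (q i) = fst (q j)" by auto
    then have "from_line (to_line (snd (q i))) = from_line (to_line (snd (q j)))" by (simp add: t_def)
    then have "snd (q i) = snd (q j)" by (simp only: from_line_to_line[OF q(3)])
    then have "q i = q j" using ij by (simp add: prod_eq_iff)
    then show False using q(1) ij by (simp add: inj_eq)
  qed
  ultimately obtain l where l: "0 < l" "l < 1" "\<And>a b. (a, b) \<in> ?A \<Longrightarrow> a + l * b \<noteq> 0"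
    by (rule exists_generic_parameter[OF _ _ zero_less_one]) (rule that)
  define d where "d i j = (t i - l * fst (q i)) - (t j - l * fst (q j))" for i j
  have d: "d i j \<noteq> 0" if "i \<noteq> j" for i j
    using l(3)[of "t i - t j" "fst (q j) - fst (q i)"] that by (force simp: d_def algebra_simps)
  \<comment> \<open>Avoiding these pairs keeps every \<open>m * d i j\<close> with
    \<open>i \<noteq> j\<close> from being an integer; \<open>(0, 0)\<close> does not occur because
    \<open>d i j \<noteq> 0\<close> by the choice of \<open>l\<close>.\<close>
  let ?B = "{(of_int k :: real, d i j) | i j k. i \<noteq> j}"
  have "?B \<subseteq> (\<lambda>(k, i, j). (of_int k, d i j)) ` UNIV"
    by (auto intro!: image_eqI[where x = "(_, _, _)"])
  then have "countable ?B" by (rule countable_subset) simp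
  moreover have "(0, 0) \<notin> ?B" using d by auto
  ultimately obtain m where m: "0 < m" "m < 1" "\<And>a b. (a, b) \<in> ?B \<Longrightarrow> a + m * b \<noteq> 0"
    by (rule exists_generic_parameter[OF _ _ zero_less_one]) (rule that)
  \<comment> \<open>In the line coordinate, \<open>\<Lambda>'\<close> is
    \<open>t \<mapsto> m * (t - l * x)\<close>, and \<open>\<Lambda>\<close> is its inverse
    \<open>t \<mapsto> t / m + l * x\<close>.\<close>
  define \<Lambda> where "\<Lambda> z = (fst z, line_affine (1 / m) (l * fst z) (snd z))" for z
  define \<Lambda>' where "\<Lambda>' z = (fst z, line_affine m (- m * l * fst z) (snd z))" for z
  show ?thesis
  proof
    show "homeomorphism sq sq \<Lambda> \<Lambda>'"
    proof (rule homeomorphismI)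
      show "continuous_on sq \<Lambda>" "continuous_on sq \<Lambda>'" unfolding \<Lambda>_def \<Lambda>'_def
        by (intro continuous_intros continuous_on_line_affine; use m in \<open>auto simp: mem_sq\<close>)+
      show "\<Lambda> ` sq \<subseteq> sq" "\<Lambda>' ` sq \<subseteq> sq"
        by (rule image_subsetI; use m(1) in \<open>simp add: \<Lambda>_def \<Lambda>'_def mem_sq abs_line_affine_le del: mem_Times_iff\<close>)+
      show "\<Lambda>' (\<Lambda> z) = z" "\<Lambda> (\<Lambda>' z) = z" if "z \<in> sq" for z
        using that line_affine_inverse[of m "snd z" "- m * l * fst z"]
          line_affine_inverse[of "1/m" "snd z" "l * fst z"] m(1)
        by (simp_all add: \<Lambda>_def \<Lambda>'_def mem_sq prod_eq_iff mult.commute mult.left_commute)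
    qed
    show "\<bar>snd (\<Lambda> z)\<bar> = 1 \<longleftrightarrow> \<bar>snd z\<bar> = 1" if "z \<in> sq" for z
    proof (cases "\<bar>snd z\<bar> = 1")
      case False
      then have "\<bar>snd z\<bar> < 1" using that by (simp add: mem_sq)
      from abs_line_affine_less[OF this, of "1/m" "l * fst z"] False show ?thesis
        by (simp add: \<Lambda>_def)
    qed (use m in \<open>simp add: \<Lambda>_def line_affine_end\<close>)
    show "\<Lambda> z = z" if "\<bar>snd z\<bar> = 1" for z
      using that m by (simp add: \<Lambda>_def line_affine_end prod_eq_iff)
    fix i j :: nat and k :: int assume "i \<noteq> j"
    have "to_line (snd (\<Lambda>' (q i))) = m * (t i - l * fst (q i))" for i
      using q(3)[of i] by (simp add: \<Lambda>'_def to_line_line_affine t_def algebra_simps)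
    then have "to_line (snd (\<Lambda>' (q i))) - to_line (snd (\<Lambda>' (q j))) = m * d i j"
      by (simp add: d_def algebra_simps)
    moreover have "of_int (- k) + m * d i j \<noteq> 0" using \<open>i \<noteq> j\<close> by (intro m) blast
    ultimately show "to_line (snd (\<Lambda>' (q i))) - to_line (snd (\<Lambda>' (q j))) \<noteq> of_int k" by simp
  qed (use q in \<open>auto simp: \<Lambda>_def \<Lambda>'_def abs_line_affine_less\<close>)
qed

text \<open>The model descends along \<open>P\<close> composed with the generic coordinates: fibres
  with several points lie in the two edges, which \<open>\<Psi>\<close> fixes pointwise. The
  coordinate change is the identity on the edges, so the targets \<open>(c j, 1)\<close> and
  \<open>(c' j, -1)\<close> are unaffected.\<close>

lemma homeomorphism_from_parametrisation:
  fixes P :: "real \<times> real \<Rightarrow> real \<times> real" and q :: "nat \<Rightarrow> real \<times> real" and c c' :: "nat \<Rightarrow> real"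
  assumes P: "continuous_on sq P" "P ` sq = sq"
    and P_inj: "\<And>u v. \<lbrakk>u \<in> sq; v \<in> sq; P u = P v\<rbrakk> \<Longrightarrow> u = v \<or> \<bar>snd u\<bar> = 1 \<and> \<bar>snd v\<bar> = 1"
    and q: "inj q" "\<And>j. \<bar>fst (q j)\<bar> < 1" "\<And>j. \<bar>snd (q j)\<bar> < 1"
    and c: "\<And>j. \<bar>c j\<bar> < 1" and c': "\<And>j. \<bar>c' j\<bar> < 1"
  obtains \<psi> \<psi>' where "homeomorphism sq sq \<psi> \<psi>'" "topological_entropy sq \<psi> = 0"
    "\<And>j. omega_limit \<psi> (P (q j)) = {P (c j, 1)}" "\<And>j. omega_limit \<psi>' (P (q j)) = {P (c' j, -1)}"
proof -
  obtain \<Lambda> \<Lambda>' where \<Lambda>: "homeomorphism sq sq \<Lambda> \<Lambda>'"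
    "\<And>z. fst (\<Lambda> z) = fst z" "\<And>z. z \<in> sq \<Longrightarrow> \<bar>snd (\<Lambda> z)\<bar> = 1 \<longleftrightarrow> \<bar>snd z\<bar> = 1"
    "\<And>z. \<bar>snd z\<bar> = 1 \<Longrightarrow> \<Lambda> z = z"
    and \<Lambda>_mod: "\<And>i j k. i \<noteq> j \<Longrightarrow> to_line (snd (\<Lambda>' (q i))) - to_line (snd (\<Lambda>' (q j))) \<noteq> of_int k"
    and \<Lambda>': "\<And>j. fst (\<Lambda>' (q j)) = fst (q j)" "\<And>j. \<bar>snd (\<Lambda>' (q j))\<bar> < 1"
    by (rule exists_generic_coordinates[OF q]) (rule that)
  have \<Lambda>_sq: "\<Lambda> ` sq = sq" "continuous_on sq \<Lambda>" "\<And>z. z \<in> sq \<Longrightarrow> \<Lambda>' (\<Lambda> z) = z"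
     "\<And>z. z \<in> sq \<Longrightarrow> \<Lambda> (\<Lambda>' z) = z"
    using \<Lambda>(1) by (auto simp: homeomorphism_def)
  define x where "x j = fst (\<Lambda>' (q j))" for j
  define s where "s j = snd (\<Lambda>' (q j))" for j
  have xs: "\<bar>x j\<bar> < 1" "\<bar>s j\<bar> < 1" for j using \<Lambda>' q by (auto simp: x_def s_def)
  obtain \<Psi> \<Psi>' where \<Psi>: "homeomorphism sq sq \<Psi> \<Psi>'"
    "\<And>z. z \<in> sq \<Longrightarrow> snd (\<Psi> z) = line_affine 1 1 (snd z)"
    "\<And>z. z \<in> sq \<Longrightarrow> \<bar>snd z\<bar> = 1 \<Longrightarrow> \<Psi> z = z"
    and lim: "\<And>j. (\<lambda>k. (\<Psi>^^k) (x j, s j)) \<longlonglongrightarrow> (c j, 1)"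
    "\<And>j. (\<lambda>k. (\<Psi>'^^k) (x j, s j)) \<longlonglongrightarrow> (c' j, -1)"
    by (rule model_homeomorphism[of x s c c', OF xs _ c c'])
      (unfold s_def, rule \<Lambda>_mod, assumption, rule that, unfold s_def)
  have \<Psi>_sq: "\<Psi> ` sq = sq" "continuous_on sq \<Psi>" "\<Psi>' ` sq = sq" "\<And>z. z \<in> sq \<Longrightarrow> \<Psi>' (\<Psi> z) = z"
    using \<Psi>(1) by (auto simp: homeomorphism_def)
  have fixed': "\<Psi>' z = z" if "z \<in> sq" "\<bar>snd z\<bar> = 1" for z
    using \<Psi>(3)[OF that] \<Psi>_sq(4)[OF that(1)] by simp
  define R where "R z = P (\<Lambda> z)" for z
  have R: "continuous_on sq R" "R ` sq = sq"
    unfolding R_def using P \<Lambda>_sq by (auto intro: continuous_on_compose2 simp: image_comp[unfolded o_def, symmetric])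
  have R_inj: "u = v \<or> \<bar>snd u\<bar> = 1 \<and> \<bar>snd v\<bar> = 1" if "u \<in> sq" "v \<in> sq" "R u = R v" for u v
  proof -
    have Peq: "P (\<Lambda> u) = P (\<Lambda> v)" using that(3) by (simp add: R_def)
    have m: "\<Lambda> u \<in> sq" "\<Lambda> v \<in> sq" using that \<Lambda>_sq(1) by blast+
    consider "\<Lambda> u = \<Lambda> v" | "\<bar>snd (\<Lambda> u)\<bar> = 1 \<and> \<bar>snd (\<Lambda> v)\<bar> = 1"
      using P_inj[OF m Peq] by blast
    then show ?thesis
    proof cases
      case 1
      then have "\<Lambda>' (\<Lambda> u) = \<Lambda>' (\<Lambda> v)" by simp
      then show ?thesis using that(1,2) by (simp only: \<Lambda>_sq(3)) simp
    qed (use \<Lambda>(3) that in blast)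
  qed
  obtain \<psi> \<psi>' where \<psi>: "homeomorphism sq sq \<psi> \<psi>'"
    "\<And>u. u \<in> sq \<Longrightarrow> \<psi> (R u) = R (\<Psi> u)" "\<And>u. u \<in> sq \<Longrightarrow> \<psi>' (R u) = R (\<Psi>' u)"
  proof (rule homeomorphism_quotient[OF compact_sq R \<Psi>(1)])
    show "R (\<Psi> u) = R (\<Psi> v) \<and> R (\<Psi>' u) = R (\<Psi>' v)" if "u \<in> sq" "v \<in> sq" "R u = R v" for u v
      using R_inj[OF that]
    proof
      assume "\<bar>snd u\<bar> = 1 \<and> \<bar>snd v\<bar> = 1"
      then show ?thesis using \<Psi>(3) fixed' that by simp
    qed simp
  qed (rule that)
  have q_eq: "P (q j) = R (x j, s j)" for j
    using \<Lambda>_sq(4)[of "q j"] q(2,3)[of j] by (simp add: R_def x_def s_def mem_sq less_imp_le)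
  have c_eq: "P (c j, 1) = R (c j, 1)" "P (c' j, -1) = R (c' j, -1)" for j
    using \<Lambda>(4) by (simp_all add: R_def)
  have mem: "(x j, s j) \<in> sq" "(c j, 1) \<in> sq" "(c' j, -1) \<in> sq" for j
    using xs[of j] c[of j] c'[of j] by (auto simp: abs_less_iff)
  show ?thesis
  proof
    show "homeomorphism sq sq \<psi> \<psi>'" by fact
    show "topological_entropy sq \<psi> = 0"
      by (rule factor_entropy_0[OF R _ _ \<Psi>(2,3) \<psi>(2)]) (use \<Psi>_sq in auto)
    show "omega_limit \<psi> (P (q j)) = {P (c j, 1)}" for j
      unfolding q_eq c_eq
      by (rule omega_limit_factor[OF R(1) \<psi>(2) _ mem(1,2) lim(1)]) (use \<Psi>_sq in auto)
    show "omega_limit \<psi>' (P (q j)) = {P (c' j, -1)}" for j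
      unfolding q_eq c_eq
      by (rule omega_limit_factor[OF R(1) \<psi>(3) _ mem(1,3) lim(2)]) (use \<Psi>_sq in auto)
  qed
qed

section \<open>Opening slits\<close>

text \<open>At each point the \<open>n\<close>-th partial sum misses at most one summand, whose
  index is at least \<open>n\<close>. Hence \<open>M \<longlonglongrightarrow> 0\<close> already
  gives uniform convergence.\<close>

lemma continuous_on_disjoint_sum:
  fixes f :: "nat \<Rightarrow> 'a::topological_space \<Rightarrow> 'b::real_normed_vector"
  assumes cont: "\<And>i. continuous_on S (f i)"
    and disj: "\<And>z i j. \<lbrakk>z \<in> S; f i z \<noteq> 0; f j z \<noteq> 0\<rbrakk> \<Longrightarrow> i = j"
    and small: "\<And>i z. z \<in> S \<Longrightarrow> norm (f i z) \<le> M i" "M \<longlonglongrightarrow> 0"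
    and F: "\<And>z i. \<lbrakk>z \<in> S; f i z \<noteq> 0\<rbrakk> \<Longrightarrow> F z = f i z" "\<And>z. \<lbrakk>z \<in> S; \<And>i. f i z = 0\<rbrakk> \<Longrightarrow> F z = 0"
  shows "continuous_on S F"
proof -
  have "uniform_limit S (\<lambda>n z. \<Sum>i<n. f i z) F sequentially"
    unfolding uniform_limit_iff
  proof (intro allI impI)
    fix e :: real assume "e > 0"
    then obtain N where N: "\<And>n. n \<ge> N \<Longrightarrow> \<bar>M n\<bar> < e"
      using small(2) by (auto simp: LIMSEQ_iff)
    have "dist (\<Sum>i<n. f i z) (F z) < e" if n: "n \<ge> N" and z: "z \<in> S" for n z
    proof (cases "\<forall>i. f i z = 0")
      case True
      then show ?thesis using F(2)[OF z] \<open>e > 0\<close> by simp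
    next
      case False
      then obtain j where j: "f j z \<noteq> 0" by blast
      have 0: "f i z = 0" if "i \<noteq> j" for i using disj[OF z _ j] that by blast
      have "(\<Sum>i<n. f i z) = (\<Sum>i<n. if i = j then f j z else 0)"
        by (intro sum.cong refl) (simp add: 0)
      also have "\<dots> = (if j < n then f j z else 0)" by simp
      finally have "dist (\<Sum>i<n. f i z) (F z) = (if j < n then 0 else norm (f j z))"
        using F(1)[OF z j] by (simp add: dist_norm)
      moreover have "norm (f j z) < e" if "\<not> j < n"
        using small(1)[OF z, of j] N[of j] that n by linarith
      ultimately show ?thesis using \<open>e > 0\<close> by simp
    qed
    then show "\<forall>\<^sub>F n in sequentially. \<forall>z\<in>S. dist (\<Sum>i<n. f i z) (F z) < e"
      using eventually_sequentially by blast
  qed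
  then show ?thesis
    by (rule uniform_limit_theorem[rotated])
      (auto intro!: always_eventually continuous_on_sum cont)
qed

section \<open>A single slit\<close>

text \<open>The map \<open>(x, 1 - u) \<mapsto> (x * slit_factor a h x v, v)\<close> with \<open>v = slit_depth a h x u\<close> sends
  the line \<open>u = 1\<close> to itself together with the slit from \<open>(0, 0)\<close> to \<open>(0, h)\<close>: a vertical push
  turns the line into the graph of a tent of height \<open>h\<close>, whose inside is then collapsed horizontally.\<close>

definition slit_depth :: "real \<Rightarrow> real \<Rightarrow> real \<Rightarrow> real \<Rightarrow> real" where
  "slit_depth a h x u = (1 - u) + h * max 0 (1 - \<bar>x\<bar> / a) * (1 + u) / 2"

definition slit_factor :: "real \<Rightarrow> real \<Rightarrow> real \<Rightarrow> real \<Rightarrow> real" where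
  "slit_factor a h x v = max 0 (min 1 (\<bar>x\<bar> / a + v / h - 1))"

context
  fixes a h :: real
  assumes a: "a > 0" and h: "0 < h" "h < 2"
begin

lemma tent_bounds: "0 \<le> h * max 0 (1 - \<bar>x\<bar> / a)" "h * max 0 (1 - \<bar>x\<bar> / a) \<le> h"
  using a h by (auto simp: mult_le_cancel_left1 mult_nonneg_nonneg)

text \<open>Two affine forms in \<open>u\<close>, anchored at the tent height for
  \<open>u = 1\<close> and at the depth 2 for \<open>u = -1\<close>. The common factor is positive
  because \<open>h < 2\<close>; this yields the bounds and bijectivity in \<open>u\<close>.\<close>

lemma slit_depth_eq:
  "slit_depth a h x u = h * max 0 (1 - \<bar>x\<bar> / a) + (1 - u) * (1 - h * max 0 (1 - \<bar>x\<bar> / a) / 2)"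
  "slit_depth a h x u = 2 - (1 + u) * (1 - h * max 0 (1 - \<bar>x\<bar> / a) / 2)"
  by (simp_all add: slit_depth_def field_simps)

lemma slit_depth_bounds:
  assumes "\<bar>u\<bar> \<le> 1"
  shows "h * max 0 (1 - \<bar>x\<bar> / a) \<le> slit_depth a h x u" "0 \<le> slit_depth a h x u" "slit_depth a h x u \<le> 2"
proof -
  have "0 \<le> (1 - u) * (1 - h * max 0 (1 - \<bar>x\<bar> / a) / 2)" "0 \<le> (1 + u) * (1 - h * max 0 (1 - \<bar>x\<bar> / a) / 2)"
    using tent_bounds[of x] h assms by (intro mult_nonneg_nonneg; linarith)+
  then show "h * max 0 (1 - \<bar>x\<bar> / a) \<le> slit_depth a h x u" "0 \<le> slit_depth a h x u"
     "slit_depth a h x u \<le> 2"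
    using tent_bounds[of x] slit_depth_eq[of x u] by linarith+
qed

lemma slit_depth_inj:
  assumes "slit_depth a h x u = slit_depth a h x u'" shows "u = u'"
proof -
  have "h * max 0 (1 - \<bar>x\<bar> / a) < 2" by (rule le_less_trans[OF tent_bounds(2) h(2)])
  then have "1 - h * max 0 (1 - \<bar>x\<bar> / a) / 2 \<noteq> 0" by simp
  then show ?thesis using assms unfolding slit_depth_eq(1) by simp
qed

lemma slit_depth_surj:
  assumes "h * max 0 (1 - \<bar>x\<bar> / a) \<le> v" "v \<le> 2"
  obtains u where "\<bar>u\<bar> \<le> 1" "slit_depth a h x u = v"
proof -
  define p where "p = 1 - h * max 0 (1 - \<bar>x\<bar> / a) / 2"
  have "h * max 0 (1 - \<bar>x\<bar> / a) < 2" by (rule le_less_trans[OF tent_bounds(2) h(2)])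
  then have p: "p > 0" by (simp add: p_def)
  let ?u = "1 - (v - h * max 0 (1 - \<bar>x\<bar> / a)) / p"
  have "(v - h * max 0 (1 - \<bar>x\<bar> / a)) / p \<le> 2"
    using p assms by (simp add: pos_divide_le_eq) (simp add: p_def)
  moreover have "0 \<le> (v - h * max 0 (1 - \<bar>x\<bar> / a)) / p" using p assms by simp
  ultimately have "\<bar>?u\<bar> \<le> 1" by (simp only: abs_le_iff) linarith
  moreover have "slit_depth a h x ?u = v"
    unfolding slit_depth_eq(1) p_def[symmetric] using p by simp
  ultimately show ?thesis by (rule that)
qed

lemma slit_factor_bounds: "0 \<le> slit_factor a h x v" "slit_factor a h x v \<le> 1"
  by (auto simp: slit_factor_def)

lemma slit_far:
  assumes "2 * a \<le> \<bar>x\<bar>"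
  shows "slit_depth a h x u = 1 - u" "0 \<le> v \<Longrightarrow> slit_factor a h x v = 1"
proof -
  have "2 \<le> \<bar>x\<bar> / a" using assms a by (simp add: field_simps)
  moreover from this have "max 0 (1 - \<bar>x\<bar> / a) = 0" by simp
  moreover have "0 \<le> v \<Longrightarrow> 0 \<le> v / h" using h by simp
  ultimately show "slit_depth a h x u = 1 - u" "0 \<le> v \<Longrightarrow> slit_factor a h x v = 1"
    by (auto simp: slit_depth_def slit_factor_def)
qed

text \<open>The factor vanishes only at depths up to the tent height, while
  \<open>slit_depth\<close> is at least the tent height, with equality only for
  \<open>u = 1\<close>.\<close>

lemma slit_factor_0D:
  assumes "slit_factor a h x v = 0" "v = slit_depth a h x u" "\<bar>u\<bar> \<le> 1"
  shows "u = 1"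
proof -
  have "\<bar>x\<bar> / a + v / h \<le> 1" using assms(1) by (simp add: slit_factor_def max_def min_def split: if_splits)
  then have "h * (\<bar>x\<bar> / a + v / h) \<le> h * 1" using h by (intro mult_left_mono) auto
  then have "v \<le> h * (1 - \<bar>x\<bar> / a)" using h by (simp add: algebra_simps)
  also have "\<dots> \<le> h * max 0 (1 - \<bar>x\<bar> / a)" using h by (intro mult_left_mono) auto
  also have "\<dots> = slit_depth a h x 1" by (simp add: slit_depth_def)
  finally have "slit_depth a h x u = slit_depth a h x 1"
    using slit_depth_bounds(1)[OF assms(3), of x] assms(2) by (simp add: slit_depth_def)
  then show ?thesis by (rule slit_depth_inj)
qed

lemma slit_factor_strict_mono:
  assumes "0 < slit_factor a h x v" "\<bar>x\<bar> < \<bar>y\<bar>"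
  shows "\<bar>x\<bar> * slit_factor a h x v < \<bar>y\<bar> * slit_factor a h y v"
proof -
  have "\<bar>x\<bar> / a \<le> \<bar>y\<bar> / a" using assms(2) a by (simp add: divide_right_mono)
  then have "slit_factor a h x v \<le> slit_factor a h y v" by (auto simp: slit_factor_def)
  then have "\<bar>x\<bar> * slit_factor a h x v \<le> \<bar>x\<bar> * slit_factor a h y v" by (intro mult_left_mono) auto
  also have "\<dots> < \<bar>y\<bar> * slit_factor a h y v"
    using assms \<open>slit_factor a h x v \<le> _\<close> by (intro mult_strict_right_mono) auto
  finally show ?thesis .
qed

text \<open>At a fixed depth, \<open>x \<mapsto> x * slit_factor a h x v\<close> has absolute value
  strictly increasing in \<open>\<bar>x\<bar>\<close> where the factor is positive. It collapses
  only points with factor 0, and these come from the line \<open>u = 1\<close>.\<close>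

lemma slit_inj:
  assumes u: "\<bar>u\<bar> \<le> 1" "\<bar>u'\<bar> \<le> 1"
    and v: "v = slit_depth a h x u" "v = slit_depth a h x' u'"
    and x: "x * slit_factor a h x v = x' * slit_factor a h x' v"
  shows "x = x' \<and> u = u' \<or> u = 1 \<and> u' = 1"
proof -
  consider "x = x'" | "slit_factor a h x v = 0" "slit_factor a h x' v = 0"
    | "0 < slit_factor a h x v" "0 < slit_factor a h x' v" "x \<noteq> x'"
    | "x = 0" "slit_factor a h x v > 0" "slit_factor a h x' v = 0"
    | "x' = 0" "slit_factor a h x' v > 0" "slit_factor a h x v = 0"
    using slit_factor_bounds(1)[of x v] slit_factor_bounds(1)[of x' v] x by fastforce
  then show ?thesis
  proof cases
    case 1
    then have "slit_depth a h x u = slit_depth a h x u'" using v by simp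
    then show ?thesis using 1 slit_depth_inj by blast
  next
    case 2
    then show ?thesis using slit_factor_0D v u by blast
  next
    case 3
    have "\<bar>x\<bar> * slit_factor a h x v = \<bar>x'\<bar> * slit_factor a h x' v"
      using arg_cong[OF x, of abs] slit_factor_bounds(1) by (simp add: abs_mult)
    then have "\<bar>x\<bar> = \<bar>x'\<bar>"
      using slit_factor_strict_mono[OF 3(1), of x'] slit_factor_strict_mono[OF 3(2), of x]
      by (metis less_irrefl linorder_less_linear)
    moreover have "sgn x = sgn x'" using arg_cong[OF x, of sgn] 3 by (simp add: sgn_mult)
    ultimately show ?thesis using 3 by (metis abs_mult_sgn)
  next
    \<comment> \<open>The factor is smallest at abscissa 0, so it cannot be positive there and
      vanish at \<open>x'\<close>.\<close>
    case 4
    have "0 \<le> \<bar>x'\<bar> / a" using a by simp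
    then have "slit_factor a h x' v \<ge> slit_factor a h x v"
      unfolding slit_factor_def 4(1) by (intro max.mono min.mono) auto
    then show ?thesis using 4 by simp
  next
    case 5
    have "0 \<le> \<bar>x\<bar> / a" using a by simp
    then have "slit_factor a h x v \<ge> slit_factor a h x' v"
      unfolding slit_factor_def 5(1) by (intro max.mono min.mono) auto
    then show ?thesis using 5 by simp
  qed
qed

lemma slit_surj:
  assumes v: "0 \<le> v" "v \<le> 2"
  obtains x u where "\<bar>u\<bar> \<le> 1" "slit_depth a h x u = v" "x * slit_factor a h x v = y"
proof (cases "y = 0")
  case True
  show ?thesis
  proof (cases "h \<le> v")
    case True
    then obtain u where "\<bar>u\<bar> \<le> 1" "slit_depth a h 0 u = v" using slit_depth_surj[of 0 v] v by auto
    then show ?thesis using \<open>y = 0\<close> that[of u 0] by simp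
  next
    case False
    \<comment> \<open>At this abscissa the tent has height exactly \<open>v\<close>, so the point of
      the slit at depth \<open>v\<close> comes from \<open>u = 1\<close>.\<close>
    let ?x = "a * (1 - v / h)"
    have "0 \<le> 1 - v / h" using False h by simp
    then have x: "\<bar>?x\<bar> / a = 1 - v / h" using a by (simp add: abs_mult)
    have "slit_depth a h ?x 1 = v"
      unfolding slit_depth_def x using v h by simp
    moreover have "slit_factor a h ?x v = 0" unfolding slit_factor_def x by simp
    ultimately show ?thesis using \<open>y = 0\<close> that[of 1 ?x] by simp
  qed
next
  case False
  let ?g = "\<lambda>x. x * slit_factor a h x v"
  \<comment> \<open>From \<open>2 * a\<close> on the factor is 1, so the value at \<open>?m\<close>
    is at least \<open>\<bar>y\<bar>\<close> and the intermediate value theorem applies. The sign of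
    \<open>y\<close> is restored by symmetry.\<close>
  let ?m = "max (2 * a) \<bar>y\<bar>"
  have "continuous_on {0..?m} ?g"
    unfolding slit_factor_def using a h by (intro continuous_intros) auto
  moreover have "?g 0 \<le> \<bar>y\<bar>" by simp
  moreover have "\<bar>y\<bar> \<le> ?g ?m" using slit_far(2)[of ?m v] v a by simp
  moreover have "0 \<le> ?m" using a by simp
  ultimately obtain x where x: "0 \<le> x" "?g x = \<bar>y\<bar>" using IVT'[of ?g 0 "\<bar>y\<bar>" ?m] by auto
  have e: "slit_factor a h (sgn y * x) v = slit_factor a h x v"
    using x False by (simp add: slit_factor_def abs_mult abs_sgn_eq)
  have pos: "0 < slit_factor a h x v"
    using x False slit_factor_bounds(1)[of x v] by (cases "slit_factor a h x v = 0") auto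
  then have "1 - \<bar>x\<bar> / a < v / h" by (simp add: slit_factor_def)
  then have "h * (1 - \<bar>x\<bar> / a) \<le> h * (v / h)" using h by (intro mult_left_mono) auto
  then have "h * max 0 (1 - \<bar>x\<bar> / a) \<le> v" using h v by (simp add: max_def)
  then obtain u where u: "\<bar>u\<bar> \<le> 1" "slit_depth a h x u = v" using slit_depth_surj v by blast
  show ?thesis
  proof (rule that[OF u(1), of "sgn y * x"])
    show "slit_depth a h (sgn y * x) u = v"
      using u x False by (simp add: slit_depth_def abs_mult abs_sgn_eq)
    show "sgn y * x * slit_factor a h (sgn y * x) v = y"
      unfolding e using x(2) by (simp add: mult.assoc sgn_mult_abs)
  qed
qed

lemma slit_tip: "slit_depth a h 0 1 = h"
  by (simp add: slit_depth_def)

text \<open>The line \<open>u = 1\<close> goes to the slit where the tent is positive and to itself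
  elsewhere; the line \<open>u = -1\<close> is kept at depth 2.\<close>

lemma slit_edge:
  assumes "\<bar>u\<bar> = 1"
  shows "\<bar>1 - slit_depth a h x u\<bar> = 1 \<or> slit_factor a h x (slit_depth a h x u) = 0"
proof (cases "u = 1")
  case True
  then have d: "slit_depth a h x u = h * max 0 (1 - \<bar>x\<bar> / a)" by (simp add: slit_depth_def)
  show ?thesis unfolding d slit_factor_def using h by (auto simp: max_def)
next
  case False
  then have "u = -1" using assms by linarith
  then show ?thesis by (simp add: slit_depth_def)
qed

end

section \<open>All slits at once\<close>

text \<open>Each slit is opened inside its own column of half-width \<open>2 * a i\<close>, from the
  side with second coordinate \<open>e i\<close>. The columns are disjoint and the map is the
  identity outside them, so injectivity and surjectivity are checked column by column;
  \<open>a\<close> and \<open>h\<close> tend to 0 to keep continuity where columns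
  accumulate.\<close>

lemma slit_map_exists:
  fixes r a h e :: "nat \<Rightarrow> real"
  assumes a: "\<And>i. a i > 0" "a \<longlonglongrightarrow> 0" and h: "\<And>i. 0 < h i" "\<And>i. h i < 2" "h \<longlonglongrightarrow> 0"
    and e: "\<And>i. \<bar>e i\<bar> = 1"
    and disj: "\<And>i j. i \<noteq> j \<Longrightarrow> 2 * a i + 2 * a j \<le> \<bar>r i - r j\<bar>"
    and inside: "\<And>i. 2 * a i \<le> 1 - \<bar>r i\<bar>"
  obtains P where "continuous_on sq P" "P ` sq = sq"
    "\<And>z z'. \<lbrakk>z \<in> sq; z' \<in> sq; P z = P z'\<rbrakk> \<Longrightarrow> z = z' \<or> \<bar>snd z\<bar> = 1 \<and> \<bar>snd z'\<bar> = 1"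
    "\<And>i. P (r i, e i) = (r i, e i * (1 - h i))"
    "\<And>z. z \<in> sq \<Longrightarrow> \<bar>fst z\<bar> = 1 \<Longrightarrow> \<bar>fst (P z)\<bar> = 1"
    "\<And>z. z \<in> sq \<Longrightarrow> \<bar>snd z\<bar> = 1 \<Longrightarrow> \<bar>snd (P z)\<bar> = 1 \<or> fst (P z) \<in> range r"
proof -
  have ee: "e i * e i = 1" for i using e[of i] by (metis abs_mult_self_eq mult_1)
  define col where "col i = {z :: real \<times> real. \<bar>fst z - r i\<bar> < 2 * a i}" for i
  have col_unique: "i = j" if "z \<in> col i" "z' \<in> col j" "fst z = fst z'" for z z' i j
    using disj[of i j] that by (fastforce simp: col_def)
  define dp where "dp i z = slit_depth (a i) (h i) (fst z - r i) (e i * snd z)" for i z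
  define fc where "fc i z = slit_factor (a i) (h i) (fst z - r i) (dp i z)" for i z
  \<comment> \<open>Multiplication by \<open>e i\<close> turns the chosen side into the line
    \<open>u = 1\<close>, and a second multiplication turns it back.\<close>
  define \<phi> where "\<phi> i z = (r i + (fst z - r i) * fc i z, e i * (1 - dp i z))" for i z
  define P where "P z = (if \<exists>i. z \<in> col i then \<phi> (SOME i. z \<in> col i) z else z)" for z
  have P_col: "P z = \<phi> i z" if "z \<in> col i" for i z
  proof -
    have "z \<in> col (SOME i. z \<in> col i)" using that by (rule someI)
    then have "(SOME i. z \<in> col i) = i" using col_unique that by blast
    with that show ?thesis unfolding P_def by auto
  qed
  have P_out: "P z = z" if "\<And>i. z \<notin> col i" for z using that by (simp add: P_def)
  have u: "\<bar>e i * snd z\<bar> \<le> 1" if "z \<in> sq" for i z using that e[of i] by (simp add: mem_sq abs_mult)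
  have dp: "0 \<le> dp i z" "dp i z \<le> 2" if "z \<in> sq" for i z
    using slit_depth_bounds[OF a(1) h(1,2) u[OF that]] by (auto simp: dp_def)
  have fc: "0 \<le> fc i z" "fc i z \<le> 1" for i z
    using slit_factor_bounds[OF a(1) h(1,2)] by (auto simp: fc_def)
  have \<phi>_out: "\<phi> i z = z" if "z \<in> sq" "z \<notin> col i" for i z
  proof -
    have far: "2 * a i \<le> \<bar>fst z - r i\<bar>" using that by (simp add: col_def)
    have "dp i z = 1 - e i * snd z" unfolding dp_def by (rule slit_far(1)[OF a(1) h(1,2) far])
    moreover have "fc i z = 1" unfolding fc_def by (rule slit_far(2)[OF a(1) h(1,2) far dp(1)[OF that(1)]])
    ultimately show ?thesis using ee[of i] by (simp add: \<phi>_def prod_eq_iff mult.assoc[symmetric])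
  qed
  have near: "\<bar>(fst z - r i) * fc i z\<bar> < 2 * a i" if "z \<in> col i" for i z
    using that fc[of i z] mult_left_le[of "fc i z" "\<bar>fst z - r i\<bar>"] by (simp add: col_def abs_mult)
  then have \<phi>_col: "\<phi> i z \<in> col i" if "z \<in> col i" for i z using that by (simp add: col_def \<phi>_def)
  have col_inside: "\<bar>fst z\<bar> < 1" if "z \<in> col i" for i z
    using that inside[of i] by (simp add: col_def)
  have \<phi>_snd: "\<bar>snd (\<phi> i z)\<bar> \<le> 1" if "z \<in> sq" for i z
    using dp[OF that, of i] e[of i] by (simp add: \<phi>_def abs_mult)
  have P_sq: "P z \<in> sq" if "z \<in> sq" for z
  proof (cases "\<exists>i. z \<in> col i")
    case True
    then obtain i where i: "z \<in> col i" by blast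
    show ?thesis using col_inside[OF \<phi>_col[OF i]] \<phi>_snd[OF that, of i] by (simp add: P_col[OF i] mem_sq)
  next
    case False then show ?thesis using P_out that by simp
  qed
  \<comment> \<open>Columns are preserved and the complement of all columns is fixed pointwise, so
    two points with equal images lie in the same column or in none.\<close>
  have P_fst: "z' \<in> col i" if "z \<in> col i" "P z = P z'" for i z z'
  proof (rule ccontr)
    assume n: "z' \<notin> col i"
    have Pz: "P z' \<in> col i" using \<phi>_col[OF that(1)] P_col[OF that(1)] that(2) by simp
    show False
    proof (cases "\<exists>j. z' \<in> col j")
      case True
      then obtain j where j: "z' \<in> col j" by blast
      then have "P z' \<in> col j" using \<phi>_col P_col by simp
      then show False using col_unique[OF Pz, of "P z'" j] j n by simp
    next
      case False
      then show False using P_out[of z'] Pz n by simp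
    qed
  qed
  show ?thesis
  proof
    \<comment> \<open>The displacements in different columns have disjoint supports and are bounded
      by \<open>4 * a i + h i\<close>.\<close>
    have "continuous_on sq (\<lambda>z. P z - z)"
    proof (rule continuous_on_disjoint_sum)
      show "continuous_on sq (\<lambda>z. \<phi> i z - z)" for i
        unfolding \<phi>_def fc_def dp_def slit_factor_def slit_depth_def
        using a(1)[of i] h(1)[of i] by (intro continuous_intros) auto
      have nz: "z \<in> col i" if "z \<in> sq" "\<phi> i z - z \<noteq> 0" for i z
        using \<phi>_out[of z i] that by auto
      then show "i = j" if "z \<in> sq" "\<phi> i z - z \<noteq> 0" "\<phi> j z - z \<noteq> 0" for i j z
        using col_unique that by blast
      show "P z - z = \<phi> i z - z" if "z \<in> sq" "\<phi> i z - z \<noteq> 0" for z i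
        using nz[OF that] P_col by simp
      show "P z - z = 0" if "z \<in> sq" "\<And>i. \<phi> i z - z = 0" for z
        using P_col P_out that by (cases "\<exists>i. z \<in> col i") auto
      show "norm (\<phi> i z - z) \<le> 4 * a i + h i" if z: "z \<in> sq" for i z
      proof (cases "z \<in> col i")
        case True
        have "fst (\<phi> i z - z) = (fst z - r i) * fc i z - (fst z - r i)" by (simp add: \<phi>_def)
        then have 1: "\<bar>fst (\<phi> i z - z)\<bar> \<le> 4 * a i" using near[OF True] True by (simp add: col_def)
        have "snd (\<phi> i z - z) = e i * (1 - dp i z - e i * snd z)"
          using ee[of i] by (simp add: \<phi>_def right_diff_distrib mult.assoc[symmetric])
        then have "\<bar>snd (\<phi> i z - z)\<bar> = \<bar>1 - dp i z - e i * snd z\<bar>" using e[of i] by (simp add: abs_mult)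
        also have "1 - dp i z - e i * snd z
            = - (h i * max 0 (1 - \<bar>fst z - r i\<bar> / a i) * ((1 + e i * snd z) / 2))"
          by (simp add: dp_def slit_depth_def)
        also have "\<bar>\<dots>\<bar> \<le> h i * 1"
          unfolding abs_minus abs_mult[of "_ * _"]
          using tent_bounds[OF a(1)[of i] h(1,2)[of i], of "fst z - r i"] u[OF z, of i] h(1)[of i]
          by (intro mult_mono) (auto simp del: mult_nonneg_nonneg)
        finally have "\<bar>snd (\<phi> i z - z)\<bar> \<le> h i" by simp
        moreover have "norm (\<phi> i z - z) \<le> \<bar>fst (\<phi> i z - z)\<bar> + \<bar>snd (\<phi> i z - z)\<bar>"
          using norm_Pair_le[of "fst (\<phi> i z - z)" "snd (\<phi> i z - z)"] unfolding prod.collapse by simp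
        ultimately show ?thesis using 1 by linarith
      next
        case False
        then show ?thesis using \<phi>_out[OF z False] a(1)[of i] h(1)[of i] by simp
      qed
      have "(\<lambda>i. 4 * a i + h i) \<longlonglongrightarrow> 4 * 0 + 0" by (intro tendsto_intros a h)
      then show "(\<lambda>i. 4 * a i + h i) \<longlonglongrightarrow> 0" by simp
    qed
    from continuous_on_add[OF this continuous_on_id]
    show "continuous_on sq P" by simp
  next
    show "P ` sq = sq"
    proof (intro equalityI image_subsetI P_sq subsetI)
      fix w assume w: "w \<in> sq"
      show "w \<in> P ` sq"
      proof (cases "\<exists>i. w \<in> col i")
        case True
        then obtain i where i: "w \<in> col i" by blast
        have "\<bar>e i * snd w\<bar> \<le> 1" by (rule u[OF w])
        then have "0 \<le> 1 - e i * snd w" "1 - e i * snd w \<le> 2" by (simp_all add: abs_le_iff)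
        then obtain x u where xu: "\<bar>u\<bar> \<le> 1" "slit_depth (a i) (h i) x u = 1 - e i * snd w"
          "x * slit_factor (a i) (h i) x (1 - e i * snd w) = fst w - r i"
          by (rule slit_surj[OF a(1)[of i] h(1,2)[of i]]) (rule that)
        define z where "z = (r i + x, e i * u)"
        have ez: "e i * snd z = u" using ee[of i] by (simp add: z_def mult.assoc[symmetric])
        \<comment> \<open>Outside the column the factor is 1, and \<open>z\<close> would have the
          same first coordinate as \<open>w\<close>, which lies inside.\<close>
        have zi: "z \<in> col i"
        proof (rule ccontr)
          assume "z \<notin> col i"
          then have far: "2 * a i \<le> \<bar>x\<bar>" by (simp add: col_def z_def)
          have "slit_factor (a i) (h i) x (1 - e i * snd w) = 1"
            using slit_far(2)[OF a(1) h(1,2) far] \<open>\<bar>e i * snd w\<bar> \<le> 1\<close> by simp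
          then show False using xu(3) far i by (simp add: col_def)
        qed
        then have "z \<in> sq" using col_inside[OF zi] xu(1) e[of i] by (simp add: mem_sq z_def abs_mult)
        moreover have "dp i z = 1 - e i * snd w" unfolding dp_def ez using xu(2) by (simp add: z_def)
        then have "P z = w"
          using xu(3) ee[of i] unfolding P_col[OF zi] \<phi>_def fc_def
          by (simp add: prod_eq_iff z_def mult.assoc[symmetric])
        ultimately show ?thesis by blast
      next
        case False
        then show ?thesis using P_out w by (intro image_eqI[of _ _ w]) auto
      qed
    qed
  next
    fix z z' assume z: "z \<in> sq" "z' \<in> sq" "P z = P z'"
    show "z = z' \<or> \<bar>snd z\<bar> = 1 \<and> \<bar>snd z'\<bar> = 1"
    proof (cases "\<exists>i. z \<in> col i \<or> z' \<in> col i")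
      case True
      then obtain i where i: "z \<in> col i" "z' \<in> col i" using P_fst z(3) by metis
      then have eq: "\<phi> i z = \<phi> i z'" using P_col z(3) by simp
      then have "e i * (1 - dp i z) = e i * (1 - dp i z')" by (simp add: \<phi>_def)
      then have d: "dp i z = dp i z'" using e[of i] by auto
      have "fst z - r i = fst z' - r i \<and> e i * snd z = e i * snd z' \<or> e i * snd z = 1 \<and> e i * snd z' = 1"
        by (rule slit_inj[OF a(1) h(1,2) u[OF z(1)] u[OF z(2)], of "dp i z"])
          (use eq d in \<open>auto simp: \<phi>_def fc_def dp_def\<close>)
      moreover have "\<bar>snd y\<bar> = 1" if "e i * snd y = 1" for y :: "real \<times> real"
        using arg_cong[OF that, of abs] e[of i] by (simp add: abs_mult)
      ultimately show ?thesis using e[of i] by (auto simp: prod_eq_iff)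
    next
      case False
      then show ?thesis using P_out z(3) by metis
    qed
  next
    fix i
    have "(r i, e i) \<in> col i" using a by (simp add: col_def)
    from P_col[OF this] show "P (r i, e i) = (r i, e i * (1 - h i))"
      using slit_tip[OF a(1)[of i] h(1,2)[of i]] ee[of i] by (simp add: \<phi>_def dp_def)
  next
    fix z :: "real \<times> real" assume "z \<in> sq" "\<bar>fst z\<bar> = 1"
    then have "P z = z" using col_inside by (intro P_out) force
    then show "\<bar>fst (P z)\<bar> = 1" using \<open>\<bar>fst z\<bar> = 1\<close> by simp
  next
    fix z :: "real \<times> real" assume z: "z \<in> sq" "\<bar>snd z\<bar> = 1"
    show "\<bar>snd (P z)\<bar> = 1 \<or> fst (P z) \<in> range r"
    proof (cases "\<exists>i. z \<in> col i")
      case True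
      then obtain i where i: "z \<in> col i" by blast
      have "\<bar>e i * snd z\<bar> = 1" using z e[of i] by (simp add: abs_mult)
      from slit_edge[OF a(1)[of i] h(1,2)[of i] this, of "fst z - r i"] show ?thesis
        using e[of i] by (auto simp: P_col[OF i] \<phi>_def fc_def dp_def abs_mult)
    qed (use P_out z in simp)
  qed
qed

section \<open>Straightening and proof of the theorem\<close>

text \<open>The shear is by a multiple of the distance \<open>u\<close> of the first coordinate to the set of
  accumulation points of the first coordinates of the \<open>z j\<close>. It therefore moves the latter
  less and less when they approach an accumulation point, and keeps them isolated.\<close>

lemma generic_shear_exists:
  fixes z :: "nat \<Rightarrow> real \<times> real" and W :: "(real \<times> real) set"
  assumes z: "inj z" "\<And>i. \<bar>fst (z i)\<bar> < 1" "\<And>i. \<bar>snd (z i)\<bar> < 1"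
    and W: "countable W" "W \<inter> range z = {}"
    and isolated: "\<And>i. \<exists>\<epsilon>>0. finite {j. \<bar>fst (z j) - fst (z i)\<bar> \<le> \<epsilon>}"
  obtains \<Theta> \<Theta>' where "homeomorphism sq sq \<Theta> \<Theta>'" "\<And>w. snd (\<Theta> w) = snd w"
    "\<And>w. w \<in> sq \<Longrightarrow> \<bar>fst w\<bar> < 1 \<Longrightarrow> \<bar>fst (\<Theta> w)\<bar> < 1"
    "\<And>i. \<exists>\<delta>>0. \<forall>j. j \<noteq> i \<longrightarrow> \<delta> \<le> \<bar>fst (\<Theta> (z i)) - fst (\<Theta> (z j))\<bar>"
    "\<And>i w. w \<in> W \<Longrightarrow> fst (\<Theta> w) \<noteq> fst (\<Theta> (z i))"
proof -
  \<comment> \<open>Including all \<open>\<bar>a\<bar> \<ge> 1\<close> makes \<open>A\<close>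
    nonempty and \<open>u\<close> vanish at \<plusminus>1, so that the shear fixes the vertical
    sides.\<close>
  define A where "A = {a. \<bar>a\<bar> \<ge> 1 \<or> (\<forall>\<epsilon>>0. infinite {j. \<bar>fst (z j) - a\<bar> < \<epsilon>})}"
  define u where "u x = infdist x A" for x
  have "1 \<in> A" by (simp add: A_def)
  then have A_ne: "A \<noteq> {}" by blast
  have u_nonneg: "0 \<le> u x" for x by (simp add: u_def infdist_nonneg)
  have u_lip: "\<bar>u x - u y\<bar> \<le> \<bar>x - y\<bar>" for x y
    using infdist_triangle_abs[of x A y] by (simp add: u_def dist_real_def)
  have u_end: "u 1 = 0" "u (-1) = 0" by (simp_all add: u_def A_def)
  have u_pos: "u (fst (z i)) > 0" for i
  proof -
    obtain \<epsilon> where \<epsilon>: "\<epsilon> > 0" "finite {j. \<bar>fst (z j) - fst (z i)\<bar> \<le> \<epsilon>}" using isolated by blast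
    \<comment> \<open>An accumulation point within \<epsilon> / 2 of \<open>fst (z i)\<close> would
      have infinitely many indices inside the finite strip; the other term is a lower bound for the
      distance to points with \<open>\<bar>a\<bar> \<ge> 1\<close>.\<close>
    let ?m = "min (\<epsilon> / 2) (1 - \<bar>fst (z i)\<bar>)"
    have "?m \<le> \<bar>fst (z i) - a\<bar>" if "a \<in> A" for a
    proof (rule ccontr)
      assume *: "\<not> ?m \<le> \<bar>fst (z i) - a\<bar>"
      then have "\<bar>a\<bar> < 1" by linarith
      then have "\<forall>\<epsilon>>0. infinite {j. \<bar>fst (z j) - a\<bar> < \<epsilon>}" using that by (simp add: A_def)
      then have "infinite {j. \<bar>fst (z j) - a\<bar> < \<epsilon> / 2}" using \<epsilon>(1) half_gt_zero by blast
      moreover have "\<bar>fst (z i) - a\<bar> < \<epsilon> / 2" using * by linarith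
      then have "{j. \<bar>fst (z j) - a\<bar> < \<epsilon> / 2} \<subseteq> {j. \<bar>fst (z j) - fst (z i)\<bar> \<le> \<epsilon>}"
        by (intro Collect_mono impI) linarith
      ultimately show False using \<epsilon>(2) finite_subset by blast
    qed
    then have "?m \<le> u (fst (z i))"
      unfolding u_def infdist_notempty[OF A_ne] by (intro cINF_greatest A_ne) (simp add: dist_real_def)
    moreover have "0 < ?m" using \<epsilon> z(2) by simp
    ultimately show ?thesis by linarith
  qed
  \<comment> \<open>Two sheared first coordinates agree exactly when \<open>a + l * b = 0\<close>
    for the corresponding pair. Positivity of \<open>u\<close> at the \<open>z i\<close> excludes
    \<open>(0, 0)\<close>.\<close>
  let ?B = "{(fst p - fst (z i), u (fst p) * snd p - u (fst (z i)) * snd (z i)) | p i. p \<in> W \<union> range z \<and> p \<noteq> z i}"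
  have "?B \<subseteq> (\<lambda>(p, i). (fst p - fst (z i), u (fst p) * snd p - u (fst (z i)) * snd (z i))) ` ((W \<union> range z) \<times> UNIV)"
    (is "_ \<subseteq> ?f ` _")
  proof
    fix y assume "y \<in> ?B"
    then obtain p i where "y = ?f (p, i)" "p \<in> W \<union> range z" by auto
    then show "y \<in> ?f ` ((W \<union> range z) \<times> UNIV)" by blast
  qed
  then have "countable ?B" by (rule countable_subset) (use W in auto)
  moreover have "(0, 0) \<notin> ?B"
  proof
    assume "(0, 0) \<in> ?B"
    then obtain p i where p: "p \<noteq> z i" "fst p = fst (z i)" "u (fst p) * snd p = u (fst (z i)) * snd (z i)"
      by force
    then have "snd p = snd (z i)" using u_pos[of i] by simp
    with p show False by (simp add: prod_eq_iff)
  qed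
  \<comment> \<open>Since \<open>u\<close> has Lipschitz constant 1, \<open>l < 1 / 2\<close> makes
    the shear a perturbation of the identity with Lipschitz constant 1/2 on each horizontal
    line.\<close>
  moreover have "(0::real) < 1 / 2" by simp
  ultimately obtain l where l: "0 < l" "l < 1 / 2" "\<And>a b. (a, b) \<in> ?B \<Longrightarrow> a + l * b \<noteq> 0"
    by (rule exists_generic_parameter) (rule that)
  define g where "g s x = x + l * u x * s" for s x
  define \<Theta> where "\<Theta> w = (g (snd w) (fst w), snd w)" for w
  have g_lip: "\<bar>(g s x - x) - (g s y - y)\<bar> \<le> \<bar>x - y\<bar> / 2" if "\<bar>s\<bar> \<le> 1" for s x y
  proof -
    have "(g s x - x) - (g s y - y) = l * (u x - u y) * s" by (simp add: g_def algebra_simps)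
    also have "\<bar>\<dots>\<bar> \<le> (1 / 2 * \<bar>x - y\<bar>) * 1"
      unfolding abs_mult using that u_lip[of x y] l by (intro mult_mono) auto
    finally show ?thesis by simp
  qed
  have g_end: "g s 1 = 1" "g s (-1) = -1" for s by (simp_all add: g_def u_end)
  have g_less: "\<bar>g s x\<bar> < 1" if "\<bar>s\<bar> \<le> 1" "\<bar>x\<bar> < 1" for s x
    using g_lip[of s x 1] g_lip[of s x "-1"] that g_end[of s] by (simp add: abs_if split: if_splits)
  have g_le: "\<bar>g s x\<bar> \<le> 1" if "\<bar>s\<bar> \<le> 1" "\<bar>x\<bar> \<le> 1" for s x
    using g_less[of s x] that g_end[of s] by (cases "\<bar>x\<bar> = 1") (auto simp: abs_if split: if_splits)
  have g_cont: "continuous_on X (g s)" for X s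
    unfolding g_def u_def by (intro continuous_intros)
  have cont: "continuous_on sq \<Theta>"
    unfolding \<Theta>_def g_def u_def by (intro continuous_intros)
  have inj: "inj_on \<Theta> sq"
  proof (rule inj_onI)
    fix w w' assume w: "w \<in> sq" "w' \<in> sq" "\<Theta> w = \<Theta> w'"
    then have e: "snd w = snd w'" "g (snd w) (fst w) = g (snd w) (fst w')" by (auto simp: \<Theta>_def)
    then have "fst w = fst w'"
      using g_lip[of "snd w" "fst w" "fst w'"] w(1) by (simp add: mem_sq abs_minus_commute)
    with e show "w = w'" by (simp add: prod_eq_iff)
  qed
  have surj: "\<Theta> ` sq = sq"
  proof (intro equalityI image_subsetI subsetI)
    show "\<Theta> w \<in> sq" if "w \<in> sq" for w using that g_le by (simp add: \<Theta>_def mem_sq)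
    fix w assume w: "w \<in> sq"
    obtain x where "-1 \<le> x" "x \<le> 1" "g (snd w) x = fst w"
      using IVT'[of "g (snd w)" "-1" "fst w" 1] g_cont g_end w by (auto simp: mem_sq abs_le_iff)
    then show "w \<in> \<Theta> ` sq"
      using w by (intro image_eqI[of _ _ "(x, snd w)"]) (auto simp: \<Theta>_def mem_sq)
  qed
  obtain \<Theta>' where hom: "homeomorphism sq sq \<Theta> \<Theta>'"
    using homeomorphism_compact[OF compact_sq cont surj inj] by blast
  have distinct: "fst (\<Theta> p) \<noteq> fst (\<Theta> (z i))" if "p \<in> W \<union> range z" "p \<noteq> z i" for p i
  proof -
    have "(fst p - fst (z i), u (fst p) * snd p - u (fst (z i)) * snd (z i)) \<in> ?B" using that by blast
    from l(3)[OF this] show ?thesis by (simp add: \<Theta>_def g_def algebra_simps)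
  qed
  show ?thesis
  proof
    show "homeomorphism sq sq \<Theta> \<Theta>'" by fact
    show "snd (\<Theta> w) = snd w" for w by (simp add: \<Theta>_def)
    show "\<bar>fst (\<Theta> w)\<bar> < 1" if "w \<in> sq" "\<bar>fst w\<bar> < 1" for w
      using that g_less by (simp add: \<Theta>_def mem_sq)
    show "fst (\<Theta> w) \<noteq> fst (\<Theta> (z i))" if "w \<in> W" for w i
      using distinct[of w i] that W(2) by blast
  next
    fix i
    define r where "r j = fst (\<Theta> (z j))" for j
    show "\<exists>\<delta>>0. \<forall>j. j \<noteq> i \<longrightarrow> \<delta> \<le> \<bar>fst (\<Theta> (z i)) - fst (\<Theta> (z j))\<bar>"
    proof (rule ccontr)
      assume "\<not> ?thesis"
      then have "\<exists>j. j \<noteq> i \<and> \<bar>r i - r j\<bar> < inverse (real (Suc n))" for n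
        unfolding r_def by (metis inverse_positive_iff_positive not_le of_nat_0_less_iff zero_less_Suc)
      \<comment> \<open>If \<open>r i\<close> were not isolated, some \<open>r (J n)\<close> would
        converge to it; pass to a subsequence whose original abscissas converge to some
        \<open>a\<close>.\<close>
      then obtain J where J: "\<And>n. J n \<noteq> i" "\<And>n. \<bar>r i - r (J n)\<bar> < inverse (real (Suc n))" by metis
      have rJ: "(\<lambda>n. r (J n)) \<longlonglongrightarrow> r i"
      proof (rule LIM_zero_cancel, rule Lim_null_comparison)
        show "\<forall>\<^sub>F n in sequentially. norm (r (J n) - r i) \<le> inverse (real (Suc n))"
          using J(2) by (auto simp: abs_minus_commute less_imp_le intro!: always_eventually)
      qed (rule LIMSEQ_inverse_real_of_nat)
      have "\<And>n. fst (z (J n)) \<in> {-1..1}" using z(2) by (auto simp: abs_less_iff less_imp_le)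
      then obtain a s where a: "strict_mono s" "((\<lambda>n. fst (z (J n))) \<circ> s) \<longlonglongrightarrow> a"
        using compact_Icc[of "-1::real" 1] unfolding compact_def by metis
      have "a \<in> A"
      proof (rule ccontr)
        \<comment> \<open>Otherwise only finitely many indices occur near \<open>a\<close>, so the
          limit \<open>r i\<close> is itself some \<open>r j\<close> with
          \<open>j \<noteq> i\<close>, contrary to genericity.\<close>
        assume "a \<notin> A"
        then obtain \<epsilon> where \<epsilon>: "\<epsilon> > 0" "finite {j. \<bar>fst (z j) - a\<bar> < \<epsilon>}" by (auto simp: A_def)
        let ?F = "{j. \<bar>fst (z j) - a\<bar> < \<epsilon>} - {i}"
        have "closed (r ` ?F)" using \<epsilon> by (intro finite_imp_closed) auto
        moreover have "\<forall>\<^sub>F n in sequentially. r (J (s n)) \<in> r ` ?F"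
          using tendstoD[OF a(2) \<epsilon>(1)] by eventually_elim (use J(1) in \<open>auto simp: dist_real_def\<close>)
        moreover have "(\<lambda>n. r (J (s n))) \<longlonglongrightarrow> r i"
          using LIMSEQ_subseq_LIMSEQ[OF rJ a(1)] by (simp add: o_def)
        ultimately have "r i \<in> r ` ?F" by (rule Lim_in_closed_set[OF _ _ sequentially_bot])
        then obtain j where "r i = r j" "j \<in> ?F" by (rule imageE)
        then show False using distinct[of "z j" i] z(1) by (simp add: r_def inj_eq)
      qed
      have lim_u: "(\<lambda>n. u (fst (z (J (s n))))) \<longlonglongrightarrow> 0"
        using tendsto_infdist[OF a(2), of A] \<open>a \<in> A\<close> by (simp add: u_def o_def)
      have shift: "\<bar>r j - fst (z j)\<bar> \<le> u (fst (z j)) / 2" for j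
      proof -
        have "r j - fst (z j) = l * u (fst (z j)) * snd (z j)" by (simp add: r_def \<Theta>_def g_def)
        also have "\<bar>\<dots>\<bar> \<le> (1 / 2 * u (fst (z j))) * 1"
          unfolding abs_mult using l z(3)[of j] u_nonneg by (intro mult_mono) auto
        finally show ?thesis by simp
      qed
      have "(\<lambda>n. r (J (s n)) - fst (z (J (s n)))) \<longlonglongrightarrow> 0"
      proof (rule Lim_null_comparison)
        show "\<forall>\<^sub>F n in sequentially. norm (r (J (s n)) - fst (z (J (s n)))) \<le> u (fst (z (J (s n)))) / 2"
          using shift by (auto intro!: always_eventually)
        show "(\<lambda>n. u (fst (z (J (s n)))) / 2) \<longlonglongrightarrow> 0"
          using tendsto_divide[OF lim_u tendsto_const[of 2]] by simp
      qed
      from tendsto_add[OF this a(2)] have "(\<lambda>n. r (J (s n))) \<longlonglongrightarrow> a" by (simp add: o_def)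
      moreover have "(\<lambda>n. r (J (s n))) \<longlonglongrightarrow> r i"
        using LIMSEQ_subseq_LIMSEQ[OF rJ a(1)] by (simp add: o_def)
      ultimately have "r i = a" using LIMSEQ_unique by blast
      then have "u (r i) = 0" using \<open>a \<in> A\<close> by (simp add: u_def)
      \<comment> \<open>The shear moves \<open>fst (z i)\<close> by at most half of its distance to
        \<open>A\<close>, so \<open>u (r i)\<close> is at least half of \<open>u (fst (z i))\<close>
        and cannot vanish.\<close>
      then show False using u_lip[of "r i" "fst (z i)"] shift[of i] u_pos[of i] by linarith
    qed
  qed
qed

section \<open>Columns for the slits and the parametrisation\<close>

lemma disjoint_columns_exist:
  fixes r :: "nat \<Rightarrow> real"
  assumes "\<And>i. \<exists>\<delta>>0. \<forall>j. j \<noteq> i \<longrightarrow> \<delta> \<le> \<bar>r i - r j\<bar>" and r: "\<And>i. \<bar>r i\<bar> < 1"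
  obtains a where "\<And>i. a i > 0" "a \<longlonglongrightarrow> 0" "\<And>i. 2 * a i \<le> 1 - \<bar>r i\<bar>"
    "\<And>i j. i \<noteq> j \<Longrightarrow> 2 * a i + 2 * a j \<le> \<bar>r i - r j\<bar>"
proof -
  obtain \<delta> where \<delta>: "\<And>i. \<delta> i > 0" "\<And>i j. j \<noteq> i \<Longrightarrow> \<delta> i \<le> \<bar>r i - r j\<bar>" using assms(1) by metis
  \<comment> \<open>A quarter of each isolation radius suffices, because
    \<open>(\<delta> i + \<delta> j) / 2\<close> is at most \<open>\<bar>r i - r j\<bar>\<close>;
    the last term forces convergence to 0.\<close>
  define a where "a i = min (min (\<delta> i / 4) ((1 - \<bar>r i\<bar>) / 2)) (inverse (real (Suc i)))" for i
  have a_le: "a i \<le> \<delta> i / 4" "a i \<le> (1 - \<bar>r i\<bar>) / 2" "a i \<le> inverse (real (Suc i))" for i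
    unfolding a_def by (rule min.coboundedI1[OF min.cobounded1] min.coboundedI1[OF min.cobounded2] min.cobounded2)+
  show ?thesis
  proof
    show pos: "a i > 0" for i unfolding a_def using \<delta>(1)[of i] r[of i] by simp
    show "a \<longlonglongrightarrow> 0"
      by (rule Lim_null_comparison[OF _ LIMSEQ_inverse_real_of_nat])
        (use pos a_le(3) in \<open>auto simp: less_imp_le intro!: always_eventually\<close>)
    show "2 * a i \<le> 1 - \<bar>r i\<bar>" for i using mult_left_mono[OF a_le(2)[of i], of 2] by simp
    show "2 * a i + 2 * a j \<le> \<bar>r i - r j\<bar>" if "i \<noteq> j" for i j
      using a_le(1)[of i] a_le(1)[of j] \<delta>(2)[of j i] \<delta>(2)[of i j] that by linarith
  qed
qed

text \<open>The parametrisation is the slit map followed by the inverse shear. In sheared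
  coordinates no point of \<open>W\<close> has the abscissa of a slit, so \<open>W\<close> avoids
  the images of the edges.\<close>

lemma parametrisation_exists:
  fixes z :: "nat \<Rightarrow> real \<times> real" and e :: "nat \<Rightarrow> real" and W :: "(real \<times> real) set"
  assumes z: "inj z" "\<And>i. \<bar>fst (z i)\<bar> < 1" "\<And>i. \<bar>snd (z i)\<bar> < 1"
    and W: "countable W" "W \<inter> range z = {}" "\<And>w. w \<in> W \<Longrightarrow> \<bar>fst w\<bar> < 1 \<and> \<bar>snd w\<bar> < 1"
    and isolated: "\<And>i. \<exists>\<epsilon>>0. finite {j. \<bar>fst (z j) - fst (z i)\<bar> \<le> \<epsilon>}"
    and e: "\<And>i. \<bar>e i\<bar> = 1" "(\<lambda>i. 1 - e i * snd (z i)) \<longlonglongrightarrow> 0"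
  obtains P r where "continuous_on sq P" "P ` sq = sq"
    "\<And>u v. \<lbrakk>u \<in> sq; v \<in> sq; P u = P v\<rbrakk> \<Longrightarrow> u = v \<or> \<bar>snd u\<bar> = 1 \<and> \<bar>snd v\<bar> = 1"
    "\<And>i. \<bar>r i\<bar> < 1" "\<And>i. P (r i, e i) = z i"
    "\<And>u. \<lbrakk>u \<in> sq; P u \<in> W\<rbrakk> \<Longrightarrow> \<bar>fst u\<bar> < 1 \<and> \<bar>snd u\<bar> < 1"
proof -
  obtain \<Theta> \<Theta>' where \<Theta>: "homeomorphism sq sq \<Theta> \<Theta>'" and \<Theta>_snd: "\<And>w. snd (\<Theta> w) = snd w"
    and \<Theta>_fst: "\<And>w. w \<in> sq \<Longrightarrow> \<bar>fst w\<bar> < 1 \<Longrightarrow> \<bar>fst (\<Theta> w)\<bar> < 1"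
    and \<Theta>_z: "\<And>i. \<exists>\<delta>>0. \<forall>j. j \<noteq> i \<longrightarrow> \<delta> \<le> \<bar>fst (\<Theta> (z i)) - fst (\<Theta> (z j))\<bar>"
    and \<Theta>_W: "\<And>i w. w \<in> W \<Longrightarrow> fst (\<Theta> w) \<noteq> fst (\<Theta> (z i))"
    by (rule generic_shear_exists[OF z W(1,2) isolated]) (rule that)
  have H: "continuous_on sq \<Theta>'" "\<Theta>' ` sq = sq" "\<And>w. w \<in> sq \<Longrightarrow> \<Theta>' (\<Theta> w) = w"
     "\<And>w. w \<in> sq \<Longrightarrow> \<Theta> (\<Theta>' w) = w"
    using \<Theta> by (auto simp: homeomorphism_def)
  define r where "r i = fst (\<Theta> (z i))" for i
  have z_sq: "z i \<in> sq" for i using z by (simp add: mem_sq less_imp_le)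
  have r: "\<bar>r i\<bar> < 1" for i using \<Theta>_fst[OF z_sq z(2)] by (simp add: r_def)
  obtain a where a: "\<And>i. a i > 0" "a \<longlonglongrightarrow> 0" "\<And>i. 2 * a i \<le> 1 - \<bar>r i\<bar>"
    "\<And>i j. i \<noteq> j \<Longrightarrow> 2 * a i + 2 * a j \<le> \<bar>r i - r j\<bar>"
    by (rule disjoint_columns_exist[of r]) (unfold r_def, rule \<Theta>_z, fold r_def, rule r, rule that)
  \<comment> \<open>The distance of \<open>z i\<close> from the line at height \<open>e i\<close>,
    which the shear preserves: the slit from that side ends exactly at the image of
    \<open>z i\<close>.\<close>
  define h where "h i = 1 - e i * snd (z i)" for i
  have "\<bar>e i * snd (z i)\<bar> < 1" for i using z(3)[of i] e(1)[of i] by (simp add: abs_mult)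
  then have h: "0 < h i" "h i < 2" for i by (auto simp: h_def abs_less_iff)
  have h0: "h \<longlonglongrightarrow> 0" using e(2) unfolding h_def .
  obtain P where P: "continuous_on sq P" "P ` sq = sq"
    and P_inj: "\<And>u v. \<lbrakk>u \<in> sq; v \<in> sq; P u = P v\<rbrakk> \<Longrightarrow> u = v \<or> \<bar>snd u\<bar> = 1 \<and> \<bar>snd v\<bar> = 1"
    and P_tip: "\<And>i. P (r i, e i) = (r i, e i * (1 - h i))"
    and P_fst: "\<And>u. u \<in> sq \<Longrightarrow> \<bar>fst u\<bar> = 1 \<Longrightarrow> \<bar>fst (P u)\<bar> = 1"
    and P_snd: "\<And>u. u \<in> sq \<Longrightarrow> \<bar>snd u\<bar> = 1 \<Longrightarrow> \<bar>snd (P u)\<bar> = 1 \<or> fst (P u) \<in> range r"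
    by (rule slit_map_exists[OF a(1,2) h h0 e(1) a(4,3)]) (assumption, rule that)
  have P_sq: "P u \<in> sq" if "u \<in> sq" for u using P(2) that by blast
  show ?thesis
  proof
    show "continuous_on sq (\<lambda>u. \<Theta>' (P u))"
      by (rule continuous_on_compose2[OF H(1) P(1)]) (use P in simp)
    show "(\<lambda>u. \<Theta>' (P u)) ` sq = sq" using P(2) H(2) by (metis image_image)
    fix u v assume uv: "u \<in> sq" "v \<in> sq" "\<Theta>' (P u) = \<Theta>' (P v)"
    have "\<Theta> (\<Theta>' (P u)) = \<Theta> (\<Theta>' (P v))" using uv(3) by simp
    then have "P u = P v" by (simp only: H(4) P_sq uv(1,2))
    with uv show "u = v \<or> \<bar>snd u\<bar> = 1 \<and> \<bar>snd v\<bar> = 1" by (intro P_inj)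
  next
    show "\<bar>r i\<bar> < 1" for i by (rule r)
    fix i
    have "e i * e i = 1" using e(1)[of i] by (metis abs_mult_self_eq mult_1)
    then have "(r i, e i * (1 - h i)) = \<Theta> (z i)"
      by (simp add: h_def r_def prod_eq_iff \<Theta>_snd mult.assoc[symmetric])
    then show "\<Theta>' (P (r i, e i)) = z i" using H(3)[OF z_sq] P_tip by simp
  next
    fix u assume u: "u \<in> sq" "\<Theta>' (P u) \<in> W"
    define w where "w = \<Theta>' (P u)"
    have w: "w \<in> W" "\<bar>fst w\<bar> < 1" "\<bar>snd w\<bar> < 1" using u W(3) by (auto simp: w_def)
    have Pu: "P u = \<Theta> w" using H(4)[OF P_sq[OF u(1)]] by (simp add: w_def)
    have "w \<in> sq" using w by (simp add: mem_sq)
    then have "\<bar>fst (P u)\<bar> \<noteq> 1" using \<Theta>_fst[of w] w by (simp add: Pu)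
    moreover have "\<bar>snd (P u)\<bar> \<noteq> 1" using w by (simp add: Pu \<Theta>_snd)
    moreover have "fst (P u) \<notin> range r" using \<Theta>_W[OF w(1)] by (auto simp: Pu r_def)
    ultimately show "\<bar>fst u\<bar> < 1 \<and> \<bar>snd u\<bar> < 1"
      using P_fst[OF u(1)] P_snd[OF u(1)] u(1) by (auto simp: mem_sq)
  qed
qed

section \<open>Assembly from the given points and dense sets\<close>

lemma one_minus_le_infdist_J: "\<bar>i - snd z\<bar> \<le> infdist z (J i)"
proof -
  have ne: "J i \<noteq> {}" by (auto simp: J_def)
  show ?thesis unfolding infdist_notempty[OF ne]
  proof (rule cINF_greatest[OF ne])
    fix y assume "y \<in> J i"
    then have "snd y = i" by (auto simp: J_def)
    then show "\<bar>i - snd z\<bar> \<le> dist z y"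
      using dist_snd_le[of z y] by (simp add: dist_real_def abs_minus_commute)
  qed
qed

theorem theorem5p1:
  fixes y1 y2 :: "nat \<Rightarrow> real \<times> real"
    and W :: "nat \<Rightarrow> (real \<times> real) set"
  defines "Y \<equiv> range y1 \<union> range y2"
  assumes Y_open_square: "Y \<subseteq> {-1<..<1} \<times> {-1<..<1}"
    and Y_enum: "inj y1" "inj y2" "\<And>n m. y1 n \<noteq> y2 m"
    and W_disj: "\<And>n m. n \<noteq> m \<Longrightarrow> W n \<inter> W m = {}"
    and W_countable: "\<And>n. countable (W n)"
    and W_sub: "\<And>n. W n \<subseteq> ({-1<..<1} \<times> {-1<..<1}) - Y"
    and W_dense: "\<And>n. {-1..1} \<times> {-1..1} \<subseteq> closure (W n)"
    and lim1: "(\<lambda>n. infdist (y1 n) (J 1)) \<longlonglongrightarrow> 0"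
    and lim2: "(\<lambda>n. infdist (y2 n) (J (-1))) \<longlonglongrightarrow> 0"
    and strips: "\<forall>\<beta>\<in>proj1 ` Y. \<exists>\<epsilon>>0. finite (Y \<inter> proj1 -` {\<beta>-\<epsilon>..\<beta>+\<epsilon>})"
  shows "\<exists>\<psi> \<psi>'. homeomorphism ({-1..1} \<times> {-1..1}) ({-1..1} \<times> {-1..1}) \<psi> \<psi>' \<and>
           topological_entropy ({-1..1} \<times> {-1..1}) \<psi> = 0 \<and>
           (\<forall>n. \<forall>w\<in>W n. omega_limit \<psi> w = {y1 n} \<and> omega_limit \<psi>' w = {y2 n})"
proof -
  \<comment> \<open>The two sequences are interleaved: even indices carry \<open>y1\<close> and
    slits from the top, odd indices carry \<open>y2\<close> and slits from the bottom.\<close>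
  define z where "z i = (if even i then y1 (i div 2) else y2 (i div 2))" for i
  define e where "e i = (if even i then 1 else -1 :: real)" for i :: nat
  have z_even: "z (2 * n) = y1 n" and z_odd: "z (2 * n + 1) = y2 n" for n by (simp_all add: z_def)
  have zY: "z i \<in> Y" for i by (simp add: z_def Y_def)
  then have z_in: "z i \<in> {-1<..<1} \<times> {-1<..<1}" for i using Y_open_square by blast
  have z: "\<bar>fst (z i)\<bar> < 1" "\<bar>snd (z i)\<bar> < 1" for i using z_in[of i] by (auto simp: abs_less_iff)
  have z_inj: "inj z"
  proof (rule injI)
    fix i j assume eq: "z i = z j"
    then have p: "even i = even j" using Y_enum(3) by (auto simp: z_def split: if_splits) (metis Y_enum(3))+
    then have "i div 2 = j div 2" using eq Y_enum(1,2) by (auto simp: z_def inj_eq split: if_splits)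
    then show "i = j" using p by (metis dvd_mult_div_cancel odd_two_times_div_two_succ)
  qed
  have isolated: "\<exists>\<epsilon>>0. finite {j. \<bar>fst (z j) - fst (z i)\<bar> \<le> \<epsilon>}" for i
  proof -
    obtain \<epsilon> where \<epsilon>: "\<epsilon> > 0" "finite (Y \<inter> proj1 -` {proj1 (z i)-\<epsilon>..proj1 (z i)+\<epsilon>})"
      using strips zY[of i] by blast
    have "{j. \<bar>fst (z j) - fst (z i)\<bar> \<le> \<epsilon>} \<subseteq> z -` (Y \<inter> proj1 -` {proj1 (z i)-\<epsilon>..proj1 (z i)+\<epsilon>})"
      using zY by (auto simp: proj1_def abs_le_iff)
    then show ?thesis using \<epsilon> z_inj finite_vimageI finite_subset by metis
  qed
  have e_lim: "(\<lambda>i. 1 - e i * snd (z i)) \<longlonglongrightarrow> 0"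
  proof (rule Lim_null_comparison)
    let ?b = "\<lambda>n. infdist (y1 n) (J 1) + infdist (y2 n) (J (-1))"
    have "\<bar>1 - e i * snd (z i)\<bar> \<le> ?b (i div 2)" for i
    proof -
      note bounds = one_minus_le_infdist_J[of 1 "y1 (i div 2)"] one_minus_le_infdist_J[of "-1" "y2 (i div 2)"]
        infdist_nonneg[of "y1 (i div 2)" "J 1"] infdist_nonneg[of "y2 (i div 2)" "J (-1)"]
      show ?thesis
      proof (cases "even i")
        case True
        then have "1 - e i * snd (z i) = 1 - snd (y1 (i div 2))" by (simp add: z_def e_def)
        with bounds show ?thesis by linarith
      next
        case False
        then have "1 - e i * snd (z i) = 1 + snd (y2 (i div 2))" by (simp add: z_def e_def)
        with bounds show ?thesis by linarith
      qed
    qed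
    then show "\<forall>\<^sub>F i in sequentially. norm (1 - e i * snd (z i)) \<le> ?b (i div 2)"
      by (auto intro!: always_eventually)
    have "?b \<longlonglongrightarrow> 0" using tendsto_add[OF lim1 lim2] by simp
    moreover have "filterlim (\<lambda>i::nat. i div 2) at_top at_top"
      unfolding filterlim_at_top eventually_sequentially
      by (metis div_le_mono nonzero_mult_div_cancel_left zero_neq_numeral)
    ultimately show "(\<lambda>i. ?b (i div 2)) \<longlonglongrightarrow> 0" by (rule filterlim_compose)
  qed
  define WW where "WW = (\<Union>n. W n)"
  have WW: "countable WW" using W_countable by (simp add: WW_def)
  have WW_z: "WW \<inter> range z = {}" using W_sub zY unfolding WW_def by blast
  have WW_in: "\<bar>fst w\<bar> < 1 \<and> \<bar>snd w\<bar> < 1" if "w \<in> WW" for w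
    using that W_sub by (fastforce simp: WW_def abs_less_iff)
  \<comment> \<open>Density enters here: a finite \<open>W 0\<close> would be closed and would
    contain the corner \<open>(1, 1)\<close>. Infinity of \<open>WW\<close> allows a bijective
    enumeration by the natural numbers.\<close>
  have "infinite WW"
  proof
    assume "finite WW"
    then have "closed (W 0)" by (intro finite_imp_closed, elim finite_subset[rotated]) (auto simp: WW_def)
    then have "(1, 1) \<in> W 0" using W_dense[of 0] by (auto simp: closure_closed)
    then show False using WW_in[of "(1, 1)"] by (auto simp: WW_def)
  qed
  obtain P r where P: "continuous_on sq P" "P ` sq = sq"
    and P_inj: "\<And>u v. \<lbrakk>u \<in> sq; v \<in> sq; P u = P v\<rbrakk> \<Longrightarrow> u = v \<or> \<bar>snd u\<bar> = 1 \<and> \<bar>snd v\<bar> = 1"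
    and r: "\<And>i. \<bar>r i\<bar> < 1" "\<And>i. P (r i, e i) = z i"
    and P_W: "\<And>u. \<lbrakk>u \<in> sq; P u \<in> WW\<rbrakk> \<Longrightarrow> \<bar>fst u\<bar> < 1 \<and> \<bar>snd u\<bar> < 1"
    by (rule parametrisation_exists[where z = z and e = e, OF z_inj z WW WW_z WW_in isolated _ e_lim])
      (assumption, simp add: e_def, rule that)
  define w where "w = from_nat_into WW"
  have w: "bij_betw w UNIV WW"
    unfolding w_def using WW \<open>infinite WW\<close> by (rule bij_betw_from_nat_into)
  then have w_mem: "w j \<in> WW" for j by (auto simp: bij_betw_def)
  have "\<exists>u. u \<in> sq \<and> P u = w j" for j
  proof -
    have "w j \<in> sq" using WW_in[OF w_mem] by (simp add: mem_sq less_imp_le)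
    then have "w j \<in> P ` sq" by (simp only: P(2))
    then obtain u where "w j = P u" "u \<in> sq" by (rule imageE)
    then have "u \<in> sq \<and> P u = w j" by simp
    then show ?thesis by (rule exI)
  qed
  then obtain q where q: "\<And>j. q j \<in> sq" "\<And>j. P (q j) = w j" by metis
  have "P (q j) \<in> WW" for j unfolding q(2) by (rule w_mem)
  then have q_in: "\<bar>fst (q j)\<bar> < 1" "\<bar>snd (q j)\<bar> < 1" for j using P_W[OF q(1)] by blast+
  have "inj q"
  proof (rule injI)
    fix i j assume "q i = q j"
    then have "w i = w j" by (simp flip: q(2))
    then show "i = j" using bij_betw_imp_inj_on[OF w] by (simp add: inj_eq)
  qed
  have "\<exists>n. w j \<in> W n" for j using w_mem[of j] by (simp add: WW_def)
  then obtain N where N: "\<And>j. w j \<in> W (N j)" by metis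
  \<comment> \<open>The targets of the \<open>j\<close>-th point are the edge points over the two
    slit tips \<open>y1 (N j)\<close> and \<open>y2 (N j)\<close>.\<close>
  obtain \<psi> \<psi>' where \<psi>: "homeomorphism sq sq \<psi> \<psi>'" "topological_entropy sq \<psi> = 0"
    "\<And>j. omega_limit \<psi> (P (q j)) = {P (r (2 * N j), 1)}"
    "\<And>j. omega_limit \<psi>' (P (q j)) = {P (r (2 * N j + 1), -1)}"
    by (rule homeomorphism_from_parametrisation[OF P P_inj \<open>inj q\<close> q_in,
          where c = "\<lambda>j. r (2 * N j)" and c' = "\<lambda>j. r (2 * N j + 1)"])
      (assumption | rule r that)+
  have "omega_limit \<psi> x = {y1 n} \<and> omega_limit \<psi>' x = {y2 n}" if "x \<in> W n" for x n
  proof -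
    have "x \<in> WW" using that by (auto simp: WW_def)
    then obtain j where j: "w j = x" using w by (auto simp: bij_betw_def)
    \<comment> \<open>Disjointness of the sets \<open>W n\<close> makes the targets assigned to the
      enumerated point the required ones.\<close>
    have "N j = n" using N[of j] j that W_disj[of "N j" n] by auto
    then show ?thesis
      using \<psi>(3,4)[of j] r(2)[of "2 * n"] r(2)[of "2 * n + 1"] by (simp add: q(2) j e_def z_even z_odd del: One_nat_def)
  qed
  with \<psi>(1,2) show ?thesis by blast
qed

end
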